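(* Let $X$ be an infinite connected Hausdorff space. Then $X$ is compact and orderable if and only if for each $p\in X$ there exists a continuous selection for $\mathscr{F}(X\setminus\{p\})$.
   Context: For a topological space $Z$, $\mathscr{F}(Z)$ is the set of all nonempty closed subsets of $Z$, endowed with the Vietoris topology, i.e. the topology generated by all collections $\langle\mathscr{V}\rangle=\{S\in\mathscr{F}(Z): S\subset\bigcup\mathscr{V}\text{ and }S\cap V\neq\varnothing\text{ for every }V\in\mathscr{V}\}$, where $\mathscr{V}$ runs over the finite families of open subsets of $Z$. The set $X\setminus\{p\}$ carries the subspace topology. A selection for $\mathscr{F}(Z)$ is a map $f:\mathscr{F}(Z)\to Z$ with $f(S)\in S$ for all $S\in\mathscr{F}(Z)$; it is continuous if it is continuous with respect to the Vietoris topology on $\mathscr{F}(Z)$. A space is orderable if its topology is the open interval topology $\mathscr{T}_\leq$ generated by some linear order $\leq$ on it (the topology generated by the open rays $\{y: y<x\}$ and $\{y: x<y\}$). *)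

theory Defs
  imports "HOL-Analysis.Analysis"
begin

definition nonempty_closed_sets :: "'a topology \<Rightarrow> 'a set set"
  where "nonempty_closed_sets Z = {S. closedin Z S \<and> S \<noteq> {}}"

definition vietoris_basic :: "'a topology \<Rightarrow> 'a set set \<Rightarrow> 'a set set"
  where "vietoris_basic Z \<V> =
    {S \<in> nonempty_closed_sets Z. S \<subseteq> \<Union>\<V> \<and> (\<forall>V\<in>\<V>. S \<inter> V \<noteq> {})}"

definition vietoris_topology :: "'a topology \<Rightarrow> 'a set topology"
  where "vietoris_topology Z =
    topology_generated_by {vietoris_basic Z \<V> | \<V>. finite \<V> \<and> (\<forall>V\<in>\<V>. openin Z V)}"

lemma topspace_vietoris_topology [simp]:
  "topspace (vietoris_topology Z) = nonempty_closed_sets Z"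
proof -
  have "vietoris_basic Z {topspace Z} = nonempty_closed_sets Z"
    by (auto simp: vietoris_basic_def nonempty_closed_sets_def dest: closedin_subset)
  then have "\<exists>\<V>. nonempty_closed_sets Z = vietoris_basic Z \<V> \<and> finite \<V> \<and> (\<forall>V\<in>\<V>. openin Z V)"
    by (intro exI[of _ "{topspace Z}"]) auto
  then show ?thesis
    unfolding vietoris_topology_def topology_generated_by_topspace
    by (auto simp: vietoris_basic_def)
qed

definition continuous_selection :: "'a topology \<Rightarrow> ('a set \<Rightarrow> 'a) \<Rightarrow> bool"
  where "continuous_selection Z f \<longleftrightarrow>
    (\<forall>S\<in>nonempty_closed_sets Z. f S \<in> S) \<and> continuous_map (vietoris_topology Z) Z f"

text \<open>The pairs \<open>(x, y) \<in> r\<close> stand for \<open>x \<le> y\<close>. The carrier \<open>A\<close> itself is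
  added to the open rays because a topology generated by a family has the union of the family as its
  underlying set, and the rays do not cover \<open>A\<close> when \<open>A\<close> is a singleton.\<close>

definition open_interval_topology :: "'a set \<Rightarrow> 'a rel \<Rightarrow> 'a topology"
  where "open_interval_topology A r =
    topology_generated_by
      (insert A ({{y \<in> A. (y, x) \<in> r \<and> y \<noteq> x} | x. x \<in> A} \<union>
                 {{y \<in> A. (x, y) \<in> r \<and> x \<noteq> y} | x. x \<in> A}))"

lemma topspace_open_interval_topology [simp]: "topspace (open_interval_topology A r) = A"
  unfolding open_interval_topology_def topology_generated_by_topspace by auto

definition orderable_space :: "'a topology \<Rightarrow> bool"
  where "orderable_space X \<longleftrightarrow>
    (\<exists>r. linear_order_on (topspace X) r \<and> X = open_interval_topology (topspace X) r)"

end

theory Submission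
  imports Defs
begin

text \<open>A continuous selection \<open>f\<close> for the closed subsets of a connected space \<open>Z\<close>
  orders \<open>Z\<close> linearly by \<open>x < y \<longleftrightarrow> f {x, y} = x\<close>, with open rays, and then \<open>f S\<close> is
  the least element of every closed \<open>S\<close>. On a connected space such an order is unique up to
  reversal, so the orders coming from the pieces of various \<open>X - {p}\<close> can be compared. A one-sided
  piece of some \<open>X - {p}\<close> has a least element, which does not cut \<open>X\<close>. If \<open>p\<close> is any
  noncut point, comparing the order of \<open>X - {p}\<close>, with least element \<open>m\<close>, to that of
  \<open>X - {m}\<close> shows that \<open>X\<close> is ordered from \<open>m\<close> to \<open>p\<close>. For \<open>q\<close> strictly
  between, the selections on \<open>X - {q}\<close> provide minima of closed sets meeting the part below
  \<open>q\<close> and maxima of those meeting the part above; this makes the order topology compact and equal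
  to that of \<open>X\<close>. Conversely, on a compact ordered \<open>X\<close> a closed subset of \<open>X - {p}\<close> is
  sent to its minimum if it meets the part below \<open>p\<close>, and to its maximum otherwise.\<close>

subsection \<open>Connected spaces with a compatible linear order\<close>

text \<open>Only openness of the rays is required, so the topology may be finer than the order
  topology; equality is obtained later from extrema of closed sets. All conditions are relative to
  the carrier, so that one relation serves on many subspaces, and they are symmetric under reversal,
  so every fact has a dual.\<close>

locale ordered_connected =
  fixes Z :: "'a topology" and lt :: "'a \<Rightarrow> 'a \<Rightarrow> bool" (infix "\<sqsubset>" 50)
  assumes conn: "connected_space Z"
    and irrefl: "x \<in> topspace Z \<Longrightarrow> \<not> x \<sqsubset> x"
    and trans: "\<lbrakk>x \<sqsubset> y; y \<sqsubset> z; x \<in> topspace Z; y \<in> topspace Z; z \<in> topspace Z\<rbrakk> \<Longrightarrow> x \<sqsubset> z"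
    and total: "\<lbrakk>x \<in> topspace Z; y \<in> topspace Z\<rbrakk> \<Longrightarrow> x \<sqsubset> y \<or> x = y \<or> y \<sqsubset> x"
    and open_lower: "x \<in> topspace Z \<Longrightarrow> openin Z {y \<in> topspace Z. y \<sqsubset> x}"
    and open_upper: "x \<in> topspace Z \<Longrightarrow> openin Z {y \<in> topspace Z. x \<sqsubset> y}"
begin

lemma asym: "\<lbrakk>x \<sqsubset> y; x \<in> topspace Z; y \<in> topspace Z\<rbrakk> \<Longrightarrow> \<not> y \<sqsubset> x"
  using irrefl trans by blast

lemma dual: "ordered_connected Z (\<lambda>x y. y \<sqsubset> x)"
  by unfold_locales (use conn irrefl trans total open_lower open_upper in blast)+

lemma closed_lower: "x \<in> topspace Z \<Longrightarrow> closedin Z {y \<in> topspace Z. \<not> x \<sqsubset> y}"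
proof -
  assume "x \<in> topspace Z"
  moreover have "{y \<in> topspace Z. \<not> x \<sqsubset> y} = topspace Z - {y \<in> topspace Z. x \<sqsubset> y}"
    by auto
  ultimately show ?thesis
    using open_upper by (metis closedin_diff closedin_topspace)
qed

lemma closed_upper: "x \<in> topspace Z \<Longrightarrow> closedin Z {y \<in> topspace Z. \<not> y \<sqsubset> x}"
  using ordered_connected.closed_lower[OF dual] .

text \<open>A closed separation of \<open>C\<close> extends to one of \<open>Z\<close>. Take
  \<open>a\<close> and \<open>b\<close> in different parts with \<open>a\<close> below
  \<open>b\<close>: everything up to \<open>a\<close> joins the first part, everything from
  \<open>b\<close> on joins the second, and the closed interval between them lies in
  \<open>C\<close> by convexity.\<close>

lemma connectedin_convex:
  assumes "C \<subseteq> topspace Z"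
    and convex: "\<And>a b c. \<lbrakk>a \<in> C; b \<in> C; c \<in> topspace Z; a \<sqsubset> c; c \<sqsubset> b\<rbrakk> \<Longrightarrow> c \<in> C"
  shows "connectedin Z C"
proof -
  have no_split: False
    if E: "closedin Z E1" "closedin Z E2" "C \<subseteq> E1 \<union> E2" "E1 \<inter> E2 \<inter> C = {}"
      and ab: "a \<in> E1 \<inter> C" "b \<in> E2 \<inter> C" "a \<sqsubset> b" for E1 E2 a b
  proof -
    define I where "I = {y \<in> topspace Z. \<not> y \<sqsubset> a} \<inter> {y \<in> topspace Z. \<not> b \<sqsubset> y}"
    define F1 where "F1 = {y \<in> topspace Z. \<not> a \<sqsubset> y} \<union> (E1 \<inter> I)"
    define F2 where "F2 = {y \<in> topspace Z. \<not> y \<sqsubset> b} \<union> (E2 \<inter> I)"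
    have tops: "a \<in> topspace Z" "b \<in> topspace Z"
      using ab assms by auto
    have IC: "I \<subseteq> C"
    proof
      fix y assume "y \<in> I"
      then have y: "y \<in> topspace Z" "\<not> y \<sqsubset> a" "\<not> b \<sqsubset> y"
        by (auto simp: I_def)
      show "y \<in> C"
        using convex[of a b y] total[of y a] total[of y b] y tops ab by auto
    qed
    have cI: "closedin Z I"
      unfolding I_def using closed_lower closed_upper tops by blast
    have c1: "closedin Z F1" unfolding F1_def
      using E cI closed_lower tops by blast
    have c2: "closedin Z F2" unfolding F2_def
      using E cI closed_upper tops by blast
    have cover: "topspace Z \<subseteq> F1 \<union> F2"
    proof
      fix y assume y: "y \<in> topspace Z"
      show "y \<in> F1 \<union> F2"
      proof (cases "a \<sqsubset> y \<and> y \<sqsubset> b")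
        case True
        then have "y \<in> I"
          using y tops asym by (auto simp: I_def)
        then show ?thesis using IC E(3) by (auto simp: F1_def F2_def)
      qed (use y in \<open>auto simp: F1_def F2_def\<close>)
    qed
    have "y \<notin> F2" if "y \<in> F1" for y
    proof
      assume "y \<in> F2"
      have y: "y \<in> topspace Z"
        using that by (auto simp: F1_def I_def)
      have "\<not> (\<not> a \<sqsubset> y \<and> \<not> y \<sqsubset> b)"
        using total trans ab(3) y tops by metis
      moreover have "y = a" if "\<not> a \<sqsubset> y" "y \<in> I"
        using that total y tops by (auto simp: I_def)
      moreover have "y = b" if "\<not> y \<sqsubset> b" "y \<in> I"
        using that total y tops by (auto simp: I_def)
      ultimately show False
        using \<open>y \<in> F1\<close> \<open>y \<in> F2\<close> ab E(4) IC unfolding F1_def F2_def by blast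
    qed
    moreover have "a \<in> F1" "b \<in> F2"
      using tops irrefl by (auto simp: F1_def F2_def)
    ultimately show False
      using conn c1 c2 cover unfolding connected_space_closedin by blast
  qed
  show ?thesis
    unfolding connectedin_closedin
  proof (intro conjI notI assms)
    assume "\<exists>E1 E2. closedin Z E1 \<and> closedin Z E2 \<and> C \<subseteq> E1 \<union> E2 \<and> E1 \<inter> E2 \<inter> C = {} \<and>
      E1 \<inter> C \<noteq> {} \<and> E2 \<inter> C \<noteq> {}"
    then obtain E1 E2 a b where E: "closedin Z E1" "closedin Z E2" "C \<subseteq> E1 \<union> E2"
        "E1 \<inter> E2 \<inter> C = {}" and ab: "a \<in> E1 \<inter> C" "b \<in> E2 \<inter> C"
      by blast
    then have "a \<noteq> b" "a \<in> topspace Z" "b \<in> topspace Z"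
      using assms by auto
    then show False
      using no_split[of E1 E2 a b] no_split[of E2 E1 b a] E ab total[of a b] by blast
  qed
qed

lemma connectedin_upper: "connectedin Z {y \<in> topspace Z. x \<sqsubset> y}" if "x \<in> topspace Z"
  by (rule connectedin_convex) (use trans that in blast)+

lemma connectedin_lower: "connectedin Z {y \<in> topspace Z. y \<sqsubset> x}" if "x \<in> topspace Z"
  by (rule connectedin_convex) (use trans that in blast)+

text \<open>With nothing between, the open ray below \<open>y\<close> is the closed ray up to
  \<open>x\<close>. It is then clopen, contains \<open>x\<close> and lacks \<open>y\<close>, against
  connectedness.\<close>

lemma dense:
  assumes "x \<in> topspace Z" "y \<in> topspace Z" "x \<sqsubset> y"
  obtains z where "z \<in> topspace Z" "x \<sqsubset> z" "z \<sqsubset> y"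
proof -
  have "\<exists>z\<in>topspace Z. x \<sqsubset> z \<and> z \<sqsubset> y"
  proof (rule ccontr)
    assume "\<not> ?thesis"
    then have "{z \<in> topspace Z. z \<sqsubset> y} = {z \<in> topspace Z. \<not> x \<sqsubset> z}"
      using total trans assms by blast
    then have "closedin Z {z \<in> topspace Z. z \<sqsubset> y}"
      using closed_lower assms by simp
    then have "{z \<in> topspace Z. z \<sqsubset> y} = {} \<or> {z \<in> topspace Z. z \<sqsubset> y} = topspace Z"
      using conn open_lower[OF assms(2)] unfolding connected_space_clopen_in by blast
    then show False
      using assms irrefl by blast
  qed
  then show thesis using that by blast
qed

lemma restrict:
  assumes "connectedin Z C"
  shows "ordered_connected (subtopology Z C) (\<sqsubset>)"
proof -
  have C: "C \<subseteq> topspace Z" "connected_space (subtopology Z C)"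
    using assms by (auto simp: connectedin_def)
  then have top: "topspace (subtopology Z C) = C"
    by auto
  show ?thesis
  proof (unfold_locales, unfold top)
    fix x assume "x \<in> C"
    then have "x \<in> topspace Z" using C by blast
    have "{y \<in> C. y \<sqsubset> x} = C \<inter> {y \<in> topspace Z. y \<sqsubset> x}"
      "{y \<in> C. x \<sqsubset> y} = C \<inter> {y \<in> topspace Z. x \<sqsubset> y}"
      using C by auto
    then show "openin (subtopology Z C) {y \<in> C. y \<sqsubset> x}"
      "openin (subtopology Z C) {y \<in> C. x \<sqsubset> y}"
      using open_lower[OF \<open>x \<in> topspace Z\<close>] open_upper[OF \<open>x \<in> topspace Z\<close>]
      by (simp_all add: openin_subtopology_Int2)
  qed (use C irrefl total trans in blast)+
qed

lemma finite_max:
  assumes "finite T" "T \<noteq> {}" "T \<subseteq> topspace Z"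
  shows "\<exists>m\<in>T. \<forall>t\<in>T. \<not> m \<sqsubset> t"
  using assms
proof (induction rule: finite_ne_induct)
  case (singleton x)
  then show ?case using irrefl by simp
next
  case (insert x F)
  then obtain m where m: "m \<in> F" "\<forall>t\<in>F. \<not> m \<sqsubset> t" by auto
  have tops: "m \<in> topspace Z" "x \<in> topspace Z" "F \<subseteq> topspace Z"
    using m insert.prems by auto
  show ?case
  proof (cases "m \<sqsubset> x")
    case True
    then have "\<forall>t\<in>insert x F. \<not> x \<sqsubset> t"
      using m tops trans[OF True] irrefl by blast
    then show ?thesis by blast
  next
    case False
    then show ?thesis using m by blast
  qed
qed

text \<open>The two open rays at \<open>x\<close> are disjoint and cover \<open>C\<close>, so
  connectedness confines \<open>C\<close> to one of them.\<close>

lemma same_side: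
  assumes "connectedin Z C" "x \<in> topspace Z" "x \<notin> C" "a \<in> C" "c \<in> C" "a \<sqsubset> x"
  shows "c \<sqsubset> x"
proof (rule ccontr)
  assume "\<not> c \<sqsubset> x"
  have C: "C \<subseteq> topspace Z" using assms(1) connectedin_subset_topspace by blast
  let ?L = "{y \<in> topspace Z. y \<sqsubset> x}" and ?R = "{y \<in> topspace Z. x \<sqsubset> y}"
  have "openin Z ?L" "openin Z ?R" using open_lower open_upper assms by blast+
  moreover have "C \<subseteq> ?L \<union> ?R" using C assms total by blast
  moreover have "?L \<inter> ?R \<inter> C = {}" using asym assms by blast
  moreover have "?L \<inter> C \<noteq> {}" "?R \<inter> C \<noteq> {}"
    using \<open>\<not> c \<sqsubset> x\<close> total C assms by blast+
  ultimately show False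
    using assms(1) unfolding connectedin by blast
qed

lemma same_side':
  assumes "connectedin Z C" "x \<in> topspace Z" "x \<notin> C" "a \<in> C" "c \<in> C" "x \<sqsubset> a"
  shows "x \<sqsubset> c"
  using ordered_connected.same_side[OF dual] assms by blast

end

text \<open>A ray of \<open>lt1\<close> is connected and omits its endpoint, so \<open>lt2\<close>
  puts it on one side of that endpoint. Agreement on one pair therefore survives replacing the lower
  point (\<open>left\<close>) or the upper point (\<open>right\<close>), and the pair
  \<open>(a, b)\<close> is moved to \<open>(a, v)\<close>, then \<open>(x, v)\<close>, then
  \<open>(x, y)\<close>.\<close>

lemma ordered_connected_agree:
  assumes "ordered_connected Z lt1" "ordered_connected Z lt2"
    and ab: "a \<in> topspace Z" "b \<in> topspace Z" "lt1 a b" "lt2 a b"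
    and xy: "x \<in> topspace Z" "y \<in> topspace Z" "lt1 x y"
  shows "lt2 x y"
proof -
  interpret o1: ordered_connected Z lt1 by fact
  interpret o2: ordered_connected Z lt2 by fact
  have left: "lt2 a' b'"
    if "lt1 a' b'" "lt1 a b'" "lt2 a b'" "a' \<in> topspace Z" "a \<in> topspace Z" "b' \<in> topspace Z"
    for a a' b'
    using o2.same_side[OF o1.connectedin_lower[of b'], of b' a a'] that o1.irrefl by blast
  have right: "lt2 a' b'"
    if "lt1 a' b'" "lt1 a' b" "lt2 a' b" "a' \<in> topspace Z" "b \<in> topspace Z" "b' \<in> topspace Z"
    for a' b b'
    using o2.same_side'[OF o1.connectedin_upper[of a'], of a' b b'] that o1.irrefl by blast
  \<comment> \<open>\<open>v\<close> is the larger of \<open>b\<close> and \<open>y\<close> in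
    \<open>lt1\<close>, hence above both \<open>a\<close> and \<open>x\<close>.\<close>
  obtain v where v: "v \<in> topspace Z" "lt1 a v" "lt1 x v" "v = y \<or> lt1 y v"
  proof (cases "lt1 b y")
    case True
    then show thesis
      using that[of y] ab xy o1.trans[of a b y] by blast
  next
    case False
    then have "y = b \<or> lt1 y b"
      using o1.total ab xy by blast
    then show thesis
      using that[of b] ab xy o1.trans[of x y b] by blast
  qed
  have "lt2 a v"
    using right[of a v b] v ab by blast
  then have "lt2 x v"
    using left[of x v a] v ab xy by blast
  then show ?thesis
    using right[of x y v] v xy by blast
qed

text \<open>Agreement on a single pair spreads to all pairs; if the orders agree on no pair,
  totality makes them opposite.\<close>

lemma ordered_connected_unique:
  assumes "ordered_connected Z lt1" "ordered_connected Z lt2"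
  shows "(\<forall>x\<in>topspace Z. \<forall>y\<in>topspace Z. lt1 x y \<longleftrightarrow> lt2 x y) \<or>
         (\<forall>x\<in>topspace Z. \<forall>y\<in>topspace Z. lt1 x y \<longleftrightarrow> lt2 y x)"
proof -
  interpret o1: ordered_connected Z lt1 by fact
  interpret o2: ordered_connected Z lt2 by fact
  show ?thesis
  proof (cases "\<exists>a\<in>topspace Z. \<exists>b\<in>topspace Z. lt1 a b \<and> lt2 a b")
    case True
    then have "lt2 x y" if "x \<in> topspace Z" "y \<in> topspace Z" "lt1 x y" for x y
      using ordered_connected_agree[OF assms] that by blast
    then show ?thesis
      using o1.total o2.asym o2.irrefl by metis
  next
    case False
    then show ?thesis
      using o1.total o2.total o1.irrefl o2.irrefl by metis
  qed
qed

subsection \<open>Selections on connected spaces\<close>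

text \<open>In a closed separation of \<open>insert p A\<close>, the part missing \<open>p\<close>
  lies in \<open>A\<close> and is closed in \<open>X\<close>. Its complement is closed as well,
  being the other part together with \<open>topspace X - A\<close>, so connectedness of
  \<open>X\<close> makes it empty. The typical \<open>A\<close> is an open ray ending at
  \<open>p\<close> or a piece of \<open>X - {p}\<close>.\<close>

lemma connectedin_insert_open_closed:
  assumes "connected_space X" "openin X A" "closedin X (insert p A)" "p \<in> topspace X"
  shows "connectedin X (insert p A)"
proof (cases "p \<in> A")
  case True
  then have "A = {} \<or> A = topspace X"
    using assms unfolding connected_space_clopen_in by (simp add: insert_absorb)
  then show ?thesis
    using True assms(1) by (auto simp: insert_absorb connectedin_topspace)
next
  case False
  have no_split: "E2 \<inter> insert p A = {}"
    if E: "closedin X E1" "closedin X E2" "insert p A \<subseteq> E1 \<union> E2"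
      "E1 \<inter> E2 \<inter> insert p A = {}" and p: "p \<in> E1" for E1 E2
  proof -
    define F1 where "F1 = (topspace X - A) \<union> (E1 \<inter> insert p A)"
    define F2 where "F2 = E2 \<inter> insert p A"
    have "closedin X F1" "closedin X F2"
      unfolding F1_def F2_def using E assms by (auto intro: closedin_Un closedin_Int)
    moreover have "topspace X \<subseteq> F1 \<union> F2" "F1 \<inter> F2 = {}"
      using E p by (auto simp: F1_def F2_def)
    moreover have "F1 \<noteq> {}"
      using p by (auto simp: F1_def)
    ultimately show ?thesis
      using assms(1) unfolding connected_space_closedin F2_def by blast
  qed
  show ?thesis
    unfolding connectedin_closedin
  proof (intro conjI notI)
    show "insert p A \<subseteq> topspace X"
      using assms openin_subset by blast
    assume "\<exists>E1 E2. closedin X E1 \<and> closedin X E2 \<and> insert p A \<subseteq> E1 \<union> E2 \<and>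
      E1 \<inter> E2 \<inter> insert p A = {} \<and> E1 \<inter> insert p A \<noteq> {} \<and> E2 \<inter> insert p A \<noteq> {}"
    then obtain E1 E2 where E: "closedin X E1" "closedin X E2" "insert p A \<subseteq> E1 \<union> E2"
      "E1 \<inter> E2 \<inter> insert p A = {}" "E1 \<inter> insert p A \<noteq> {}" "E2 \<inter> insert p A \<noteq> {}"
      by blast
    then show False
      using no_split[of E1 E2] no_split[of E2 E1] by blast
  qed
qed

section \<open>Continuity and open sets in the Vietoris topology\<close>

lemma openin_vietoris_basic:
  assumes "finite \<V>" "\<And>V. V \<in> \<V> \<Longrightarrow> openin Z V"
  shows "openin (vietoris_topology Z) (vietoris_basic Z \<V>)"
  unfolding vietoris_topology_def by (rule topology_generated_by_Basis) (use assms in blast)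

lemma continuous_map_vietorisI:
  assumes "\<And>y. y \<in> topspace T \<Longrightarrow> g y \<in> nonempty_closed_sets Z"
    and "\<And>\<V>. \<lbrakk>finite \<V>; \<And>V. V \<in> \<V> \<Longrightarrow> openin Z V\<rbrakk>
           \<Longrightarrow> openin T {y \<in> topspace T. g y \<in> vietoris_basic Z \<V>}"
  shows "continuous_map T (vietoris_topology Z) g"
  unfolding vietoris_topology_def
proof (rule continuous_on_generated_topo)
  fix U assume "U \<in> {vietoris_basic Z \<V> |\<V>. finite \<V> \<and> (\<forall>V\<in>\<V>. openin Z V)}"
  then obtain \<V> where \<V>: "U = vietoris_basic Z \<V>" "finite \<V>" "\<And>V. V \<in> \<V> \<Longrightarrow> openin Z V"
    by blast
  have "g -` U \<inter> topspace T = {y \<in> topspace T. g y \<in> vietoris_basic Z \<V>}"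
    using \<V>(1) by auto
  then show "openin T (g -` U \<inter> topspace T)"
    using assms(2) \<V> by simp
next
  have "topspace (vietoris_topology Z) = nonempty_closed_sets Z"
    by simp
  then show "g ` topspace T \<subseteq> \<Union> {vietoris_basic Z \<V> |\<V>. finite \<V> \<and> (\<forall>V\<in>\<V>. openin Z V)}"
    using assms(1) unfolding vietoris_topology_def topology_generated_by_topspace by blast
qed

lemma continuous_map_insert_vietoris:
  assumes Z: "t1_space Z" and T: "finite T" "T \<subseteq> topspace Z"
  shows "continuous_map Z (vietoris_topology Z) (\<lambda>y. insert y T)"
proof (rule continuous_map_vietorisI)
  show nc: "insert y T \<in> nonempty_closed_sets Z" if "y \<in> topspace Z" for y
    using that Z T by (auto simp: nonempty_closed_sets_def t1_space_closedin_finite)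
  fix \<V> assume \<V>: "finite \<V>" "\<And>V. V \<in> \<V> \<Longrightarrow> openin Z V"
  show "openin Z {y \<in> topspace Z. insert y T \<in> vietoris_basic Z \<V>}"
  proof (cases "T \<subseteq> \<Union>\<V>")
    case True
    \<comment> \<open>Members of \<open>\<V>\<close> that meet \<open>T\<close> impose nothing on
      \<open>y\<close>, so \<open>y\<close> must lie in the union and in each member that
      \<open>T\<close> misses. The inner \<open>topspace Z\<close> takes care of the empty
      intersection.\<close>
    have "{y \<in> topspace Z. insert y T \<in> vietoris_basic Z \<V>} =
      topspace Z \<inter> (\<Union>\<V> \<inter> (topspace Z \<inter> \<Inter>{V \<in> \<V>. T \<inter> V = {}}))"
      using True nc by (auto simp: vietoris_basic_def)
    moreover have "openin Z (topspace Z \<inter> (\<Union>\<V> \<inter> (topspace Z \<inter> \<Inter>{V \<in> \<V>. T \<inter> V = {}})))"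
      using \<V> by (intro openin_Int openin_Union openin_Int_Inter) auto
    ultimately show ?thesis by simp
  next
    case False
    then have empty: "{y \<in> topspace Z. insert y T \<in> vietoris_basic Z \<V>} = {}"
      by (auto simp: vietoris_basic_def)
    show ?thesis
      unfolding empty by simp
  qed
qed

text \<open>For a basic set, \<open>F\<close> holds one point of \<open>S\<close> in each member of
  \<open>\<V>\<close>: a set between \<open>F\<close> and \<open>S\<close> still meets every member
  and inherits the covering from \<open>S\<close>. Intersections take the union of two cores. This
  carries statements about finite sets over to closed sets.\<close>

lemma vietoris_open_finite_core:
  assumes "openin (vietoris_topology Z) W" "S \<in> W"
  obtains F where "finite F" "F \<subseteq> S"
    "\<And>T. \<lbrakk>T \<in> nonempty_closed_sets Z; F \<subseteq> T; T \<subseteq> S\<rbrakk> \<Longrightarrow> T \<in> W"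
proof -
  let ?P = "\<lambda>W. \<forall>S\<in>W. \<exists>F. finite F \<and> F \<subseteq> S \<and>
    (\<forall>T. T \<in> nonempty_closed_sets Z \<and> F \<subseteq> T \<and> T \<subseteq> S \<longrightarrow> T \<in> W)"
  have "generate_topology_on {vietoris_basic Z \<V> |\<V>. finite \<V> \<and> (\<forall>V\<in>\<V>. openin Z V)} W"
    using assms(1) unfolding vietoris_topology_def by (rule openin_topology_generated_by)
  then have "?P W"
  proof induction
    case (Int a b)
    show ?case
    proof
      fix S assume "S \<in> a \<inter> b"
      then obtain F G where "finite F" "F \<subseteq> S" "finite G" "G \<subseteq> S"
        "\<forall>T. T \<in> nonempty_closed_sets Z \<and> F \<subseteq> T \<and> T \<subseteq> S \<longrightarrow> T \<in> a"
        "\<forall>T. T \<in> nonempty_closed_sets Z \<and> G \<subseteq> T \<and> T \<subseteq> S \<longrightarrow> T \<in> b"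
        using Int.IH by (metis IntE)
      then show "\<exists>F. finite F \<and> F \<subseteq> S \<and>
          (\<forall>T. T \<in> nonempty_closed_sets Z \<and> F \<subseteq> T \<and> T \<subseteq> S \<longrightarrow> T \<in> a \<inter> b)"
        by (intro exI[of _ "F \<union> G"]) auto
    qed
  next
    case (UN K)
    show ?case
    proof
      fix S assume "S \<in> \<Union>K"
      then obtain k where "k \<in> K" "S \<in> k" by blast
      then obtain F where "finite F" "F \<subseteq> S"
        "\<forall>T. T \<in> nonempty_closed_sets Z \<and> F \<subseteq> T \<and> T \<subseteq> S \<longrightarrow> T \<in> k"
        using UN.IH[of k] by metis
      then show "\<exists>F. finite F \<and> F \<subseteq> S \<and>
          (\<forall>T. T \<in> nonempty_closed_sets Z \<and> F \<subseteq> T \<and> T \<subseteq> S \<longrightarrow> T \<in> \<Union>K)"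
        using \<open>k \<in> K\<close> by (intro exI[of _ F]) auto
    qed
  next
    case (Basis s)
    then obtain \<V> where \<V>: "s = vietoris_basic Z \<V>" "finite \<V>"
      by blast
    show ?case
    proof
      fix S assume S: "S \<in> s"
      then have "\<forall>V\<in>\<V>. \<exists>x. x \<in> S \<inter> V"
        unfolding \<V>(1) vietoris_basic_def by auto
      then obtain c where c: "\<And>V. V \<in> \<V> \<Longrightarrow> c V \<in> S \<inter> V"
        by metis
      show "\<exists>F. finite F \<and> F \<subseteq> S \<and>
          (\<forall>T. T \<in> nonempty_closed_sets Z \<and> F \<subseteq> T \<and> T \<subseteq> S \<longrightarrow> T \<in> s)"
      proof (intro exI[of _ "c ` \<V>"] conjI allI impI)
        show "finite (c ` \<V>)" "c ` \<V> \<subseteq> S"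
          using \<V>(2) c by auto
        fix T assume T: "T \<in> nonempty_closed_sets Z \<and> c ` \<V> \<subseteq> T \<and> T \<subseteq> S"
        then have "T \<inter> V \<noteq> {}" if "V \<in> \<V>" for V
          using c[OF that] that by auto
        moreover have "T \<subseteq> \<Union>\<V>"
          using S T unfolding \<V>(1) vietoris_basic_def by auto
        ultimately show "T \<in> s"
          using T unfolding \<V>(1) vietoris_basic_def by simp
      qed
    qed
  qed auto
  from bspec[OF this assms(2)] obtain F where "finite F" "F \<subseteq> S"
    "\<forall>T. T \<in> nonempty_closed_sets Z \<and> F \<subseteq> T \<and> T \<subseteq> S \<longrightarrow> T \<in> W"
    by (elim exE conjE)
  then show thesis
    using that[of F] by simp
qed

lemma continuous_selection_in:
  "\<lbrakk>continuous_selection Z f; closedin Z S; S \<noteq> {}\<rbrakk> \<Longrightarrow> f S \<in> S"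
  by (auto simp: continuous_selection_def nonempty_closed_sets_def)

text \<open>Closed subsets of \<open>C\<close> are closed in \<open>Z\<close>, and a basic Vietoris
  set of \<open>Z\<close> pulls back to the basic set of the traces on \<open>C\<close>; so the
  inclusion of hyperspaces is continuous and \<open>f\<close> itself restricts.\<close>

lemma continuous_selection_closed_subspace:
  assumes f: "continuous_selection Z f" and C: "closedin Z C"
  shows "continuous_selection (subtopology Z C) f"
  unfolding continuous_selection_def
proof
  let ?Y = "subtopology Z C"
  have sub: "S \<in> nonempty_closed_sets Z" "S \<subseteq> C" if "S \<in> nonempty_closed_sets ?Y" for S
    using that C by (auto simp: nonempty_closed_sets_def closedin_closed_subtopology)
  then show in_S: "\<forall>S\<in>nonempty_closed_sets ?Y. f S \<in> S"
    using f by (auto simp: continuous_selection_def)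
  have "continuous_map (vietoris_topology ?Y) (vietoris_topology Z) id"
  proof (rule continuous_map_vietorisI)
    fix \<V> assume \<V>: "finite \<V>" "\<And>V. V \<in> \<V> \<Longrightarrow> openin Z V"
    have "{S \<in> topspace (vietoris_topology ?Y). id S \<in> vietoris_basic Z \<V>} =
      vietoris_basic ?Y ((\<lambda>V. C \<inter> V) ` \<V>)"
      using sub by (fastforce simp: vietoris_basic_def)
    moreover have "openin (vietoris_topology ?Y) (vietoris_basic ?Y ((\<lambda>V. C \<inter> V) ` \<V>))"
      using \<V> by (intro openin_vietoris_basic) (auto intro: openin_subtopology_Int2)
    ultimately show "openin (vietoris_topology ?Y)
        {S \<in> topspace (vietoris_topology ?Y). id S \<in> vietoris_basic Z \<V>}"
      by simp
  qed (use sub in auto)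
  then have "continuous_map (vietoris_topology ?Y) Z (f \<circ> id)"
    using f continuous_map_compose unfolding continuous_selection_def by blast
  then show "continuous_map (vietoris_topology ?Y) ?Y f"
    using in_S sub by (fastforce simp: continuous_map_in_subtopology)
qed

section \<open>The linear order induced by a selection on a connected space\<close>

definition selection_less :: "('a set \<Rightarrow> 'a) \<Rightarrow> 'a \<Rightarrow> 'a \<Rightarrow> bool"
  where "selection_less f x y \<longleftrightarrow> x \<noteq> y \<and> f {x, y} = x"

locale connected_selection =
  fixes Z :: "'a topology" and f :: "'a set \<Rightarrow> 'a"
  assumes conn_space: "connected_space Z" and haus: "Hausdorff_space Z"
    and sel: "continuous_selection Z f"
begin

lemma finite_closed: "\<lbrakk>finite T; T \<subseteq> topspace Z\<rbrakk> \<Longrightarrow> closedin Z T"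
  using Hausdorff_imp_t1_space[OF haus] by (simp add: t1_space_closedin_finite)

lemma sel_in: "\<lbrakk>closedin Z S; S \<noteq> {}\<rbrakk> \<Longrightarrow> f S \<in> S"
  using continuous_selection_in[OF sel] .

lemma sel_pair: "\<lbrakk>x \<in> topspace Z; y \<in> topspace Z\<rbrakk> \<Longrightarrow> f {x, y} = x \<or> f {x, y} = y"
  using sel_in[of "{x, y}"] finite_closed[of "{x, y}"] by auto

lemma continuous_insert:
  assumes "finite T" "T \<subseteq> topspace Z"
  shows "continuous_map Z Z (\<lambda>y. f (insert y T))"
proof -
  have "continuous_map Z (vietoris_topology Z) (\<lambda>y. insert y T)"
    by (rule continuous_map_insert_vietoris[OF Hausdorff_imp_t1_space[OF haus] assms])
  moreover have "continuous_map (vietoris_topology Z) Z f"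
    using sel unfolding continuous_selection_def by blast
  ultimately have "continuous_map Z Z (f \<circ> (\<lambda>y. insert y T))"
    by (rule continuous_map_compose)
  then show ?thesis by (simp add: o_def)
qed

lemma open_insert_preimage:
  assumes "finite T" "T \<subseteq> topspace Z" "openin Z U"
  shows "openin Z {y \<in> topspace Z. f (insert y T) \<in> U}"
  using openin_continuous_map_preimage[OF continuous_insert] assms by blast

text \<open>Let \<open>U\<close> and \<open>V\<close> be disjoint neighbourhoods of \<open>x\<close>
  and \<open>y\<close>. For \<open>z\<close> in \<open>V\<close> near \<open>y\<close>, the value at
  \<open>{z, x}\<close> stays in \<open>V\<close> if it was \<open>y\<close>, hence is
  \<open>z\<close>; it stays in \<open>U\<close> if it was \<open>x\<close>, hence is
  \<open>x\<close>.\<close>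

lemma open_selection_rays:
  assumes x: "x \<in> topspace Z"
  shows "openin Z {y \<in> topspace Z. selection_less f y x}"
    and "openin Z {y \<in> topspace Z. selection_less f x y}"
proof -
  have sep: "\<exists>U V. openin Z U \<and> openin Z V \<and> x \<in> U \<and> y \<in> V \<and> disjnt U V"
    if "y \<in> topspace Z" "y \<noteq> x" for y
    using haus x that unfolding Hausdorff_space_def by blast
  show "openin Z {y \<in> topspace Z. selection_less f y x}"
  proof (subst openin_subopen, intro ballI)
    fix y assume "y \<in> {y \<in> topspace Z. selection_less f y x}"
    then have y: "y \<in> topspace Z" "y \<noteq> x" "f {y, x} = y"
      by (auto simp: selection_less_def)
    then obtain U V where UV: "openin Z U" "openin Z V" "x \<in> U" "y \<in> V" "disjnt U V"
      using sep by metis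
    define W where "W = V \<inter> {z \<in> topspace Z. f (insert z {x}) \<in> V}"
    have "openin Z W"
      unfolding W_def using UV x by (intro openin_Int open_insert_preimage) auto
    moreover have "y \<in> W"
      using y UV by (auto simp: W_def)
    moreover have "W \<subseteq> {y \<in> topspace Z. selection_less f y x}"
      using sel_pair[OF _ x] UV by (auto simp: W_def selection_less_def disjnt_iff) metis
    ultimately show "\<exists>T. openin Z T \<and> y \<in> T \<and> T \<subseteq> {y \<in> topspace Z. selection_less f y x}"
      by blast
  qed
  show "openin Z {y \<in> topspace Z. selection_less f x y}"
  proof (subst openin_subopen, intro ballI)
    fix y assume "y \<in> {y \<in> topspace Z. selection_less f x y}"
    then have y: "y \<in> topspace Z" "y \<noteq> x" "f {y, x} = x"
      by (auto simp: selection_less_def insert_commute)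
    then obtain U V where UV: "openin Z U" "openin Z V" "x \<in> U" "y \<in> V" "disjnt U V"
      using sep by metis
    define W where "W = V \<inter> {z \<in> topspace Z. f (insert z {x}) \<in> U}"
    have "openin Z W"
      unfolding W_def using UV x by (intro openin_Int open_insert_preimage) auto
    moreover have "y \<in> W"
      using y UV by (auto simp: W_def)
    moreover have "W \<subseteq> {y \<in> topspace Z. selection_less f x y}"
      using sel_pair[OF _ x] UV
      by (auto simp: W_def selection_less_def disjnt_iff insert_commute) metis
    ultimately show "\<exists>T. openin Z T \<and> y \<in> T \<and> T \<subseteq> {y \<in> topspace Z. selection_less f x y}"
      by blast
  qed
qed

lemma selection_total:
  "\<lbrakk>x \<in> topspace Z; y \<in> topspace Z\<rbrakk> \<Longrightarrow> selection_less f x y \<or> x = y \<or> selection_less f y x"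
  using sel_pair[of x y] by (auto simp: selection_less_def insert_commute)

lemma selection_asym: "selection_less f x y \<Longrightarrow> \<not> selection_less f y x"
  by (auto simp: selection_less_def insert_commute)

text \<open>The closed lower ray at \<open>y\<close> is connected and omits \<open>z\<close>, so it
  lies on one side of \<open>z\<close>. Its point \<open>y\<close> is below \<open>z\<close>, hence
  so is \<open>x\<close>. Connectedness of the ray comes from
  \<open>connectedin_insert_open_closed\<close>, which does not presuppose transitivity.\<close>

lemma selection_trans:
  assumes xyz: "x \<in> topspace Z" "y \<in> topspace Z" "z \<in> topspace Z"
    and less: "selection_less f x y" "selection_less f y z"
  shows "selection_less f x z"
proof -
  let ?L = "\<lambda>x. {t \<in> topspace Z. selection_less f t x}"
  let ?R = "\<lambda>x. {t \<in> topspace Z. selection_less f x t}"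
  have "insert y (?L y) = topspace Z - ?R y"
    using xyz selection_total selection_asym by (auto simp: selection_less_def)
  then have "closedin Z (insert y (?L y))"
    using open_selection_rays xyz by (simp add: closedin_diff)
  then have "connectedin Z (insert y (?L y))"
    using connectedin_insert_open_closed conn_space open_selection_rays xyz by metis
  moreover have "openin Z (?L z)" "openin Z (?R z)"
    using open_selection_rays xyz by blast+
  moreover have "z \<notin> insert y (?L y)"
    using less selection_asym by (auto simp: selection_less_def)
  then have "insert y (?L y) \<subseteq> ?L z \<union> ?R z"
    using selection_total xyz by blast
  moreover have "?L z \<inter> ?R z \<inter> insert y (?L y) = {}"
    using selection_asym by blast
  moreover have "?L z \<inter> insert y (?L y) \<noteq> {}"
    using less xyz by blast
  ultimately have "?R z \<inter> insert y (?L y) = {}"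
    unfolding connectedin by blast
  then show ?thesis
    using less xyz selection_total \<open>z \<notin> insert y (?L y)\<close> by blast
qed

sublocale ordered_connected Z "selection_less f"
proof
  show "connected_space Z" by (rule conn_space)
  show "\<not> selection_less f x x" for x
    by (simp add: selection_less_def)
  show "selection_less f x z" if "selection_less f x y" "selection_less f y z"
    "x \<in> topspace Z" "y \<in> topspace Z" "z \<in> topspace Z" for x y z
    using selection_trans that by metis
  show "selection_less f x y \<or> x = y \<or> selection_less f y x"
    if "x \<in> topspace Z" "y \<in> topspace Z" for x y
    using selection_total that .
qed (rule open_selection_rays; assumption)+

text \<open>Induction on the size of \<open>T\<close>: split off the greatest point
  \<open>m\<close>, leaving \<open>T'\<close> with selected minimum \<open>a\<close> and greatest
  point \<open>b\<close>. As \<open>y\<close> ranges over the connected closed ray from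
  \<open>b\<close> on, the value at \<open>insert y T'\<close> is constantly \<open>a\<close>: at
  \<open>y = b\<close> the set is \<open>T'\<close>, and at \<open>y = m\<close> it is
  \<open>T\<close>.\<close>

lemma finite_min:
  assumes "finite T" "T \<subseteq> topspace Z" "t \<in> T"
  shows "\<not> selection_less f t (f T)"
  using assms
proof (induction "card T" arbitrary: T t rule: less_induct)
  case less
  obtain m where m: "m \<in> T" "\<And>t. t \<in> T \<Longrightarrow> \<not> selection_less f m t"
    using finite_max[of T] less.prems by blast
  define T' where "T' = T - {m}"
  have T: "T = insert m T'" and T': "finite T'" "T' \<subseteq> topspace Z" "m \<notin> T'"
    and mZ: "m \<in> topspace Z"
    using m less.prems by (auto simp: T'_def)
  have below_m: "selection_less f t m" if "t \<in> T'" for t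
    using selection_total[of t m] m(2)[of t] that T T' mZ by blast
  show ?case
  proof (cases "T' = {}")
    case True
    then show ?thesis
      using sel_in[of T] finite_closed[of T] T less.prems irrefl by auto
  next
    case False
    define a where "a = f T'"
    have a: "a \<in> T'" "\<And>t. t \<in> T' \<Longrightarrow> \<not> selection_less f t a"
    proof -
      show "a \<in> T'"
        unfolding a_def using sel_in finite_closed T' False by blast
      show "\<not> selection_less f t a" if "t \<in> T'" for t
        unfolding a_def using less.hyps[of T' t] T' that T by simp
    qed
    obtain b where b: "b \<in> T'" "\<And>t. t \<in> T' \<Longrightarrow> \<not> selection_less f b t"
      using finite_max[of T'] False T' by blast
    have ab: "a \<in> topspace Z" "b \<in> topspace Z"
      using a b T' by auto
    have "f T = a"
    proof (cases "a = b")
      case True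
      then have "T' = {a}"
        using a b selection_total T' by blast
      then show ?thesis
        using below_m[OF a(1)] T by (simp add: selection_less_def insert_commute)
    next
      case False
      then have "selection_less f a b"
        using a b selection_total ab by blast
      \<comment> \<open>\<open>c\<close> keeps the neighbourhood \<open>U\<close> of
        \<open>a\<close> strictly below \<open>b\<close>, so the moving point \<open>y\<close> is
        never in \<open>U\<close>. Since \<open>U\<close> also omits the rest of \<open>T'\<close>,
        a value in \<open>U\<close> must be \<open>a\<close>.\<close>
      then obtain c where c: "c \<in> topspace Z" "selection_less f a c" "selection_less f c b"
        using dense ab by blast
      let ?I = "{y \<in> topspace Z. \<not> selection_less f y b}"
      \<comment> \<open>As \<open>y\<close> moves up from \<open>b\<close> to \<open>m\<close>, the value \<open>f (insert y T')\<close> cannot jump away from \<open>a\<close>.\<close>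
      define U where "U = {y \<in> topspace Z. selection_less f y c} \<inter> (topspace Z - (T' - {a}))"
      define A where "A = {y \<in> topspace Z. f (insert y T') \<in> U}"
      define B where "B = {y \<in> topspace Z. f (insert y T') \<in> topspace Z - {a}}"
      have fin: "f (insert y T') \<in> insert y T'" if "y \<in> topspace Z" for y
        using that T' by (intro sel_in finite_closed) auto
      have closed_T': "closedin Z (T' - {a})"
        using T' by (intro finite_closed) auto
      have "openin Z U"
        unfolding U_def using open_lower[OF c(1)] closed_T'
        by (intro openin_Int openin_diff) auto
      then have "openin Z A"
        unfolding A_def using open_insert_preimage T' by blast
      moreover have "openin Z B"
        unfolding B_def using open_insert_preimage T' finite_closed[of "{a}"] ab by blast
      moreover have "?I \<subseteq> A \<union> B"
      proof
        fix y assume "y \<in> ?I"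
        then have y: "y \<in> topspace Z" by blast
        then have "f (insert y T') \<in> topspace Z"
          using fin[OF y] T' y by auto
        moreover have "a \<in> U"
          using ab c by (auto simp: U_def)
        ultimately show "y \<in> A \<union> B"
          using y by (cases "f (insert y T') = a") (auto simp: A_def B_def)
      qed
      moreover have "A \<inter> B \<inter> ?I = {}"
      proof (rule ccontr)
        assume "A \<inter> B \<inter> ?I \<noteq> {}"
        then obtain y where y: "y \<in> topspace Z" "\<not> selection_less f y b"
          "f (insert y T') \<in> U" "f (insert y T') \<noteq> a"
          by (auto simp: A_def B_def)
        then have "f (insert y T') = y" "selection_less f y c"
          using fin[OF y(1)] by (auto simp: U_def)
        then show False
          using y(2) trans[of y c b] y(1) c ab by blast
      qed
      moreover have "b \<in> A \<inter> ?I"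
      proof -
        have "f (insert b T') = a"
          using b by (simp add: a_def insert_absorb)
        then show ?thesis
          using ab c irrefl by (auto simp: A_def U_def)
      qed
      moreover have "connectedin Z ?I"
        by (rule connectedin_convex) (use trans ab in blast)+
      ultimately have "B \<inter> ?I = {}"
        unfolding connectedin by blast
      moreover have "m \<in> ?I"
        using mZ m b T by auto
      ultimately have "m \<notin> B" by blast
      then show ?thesis
        using mZ fin[OF mZ] T T' by (auto simp: B_def)
    qed
    then show ?thesis
      using a(2) below_m[OF a(1)] T less.prems(3) selection_asym by blast
  qed
qed

text \<open>If \<open>s\<close> were below \<open>f S\<close>, then being selected above
  \<open>s\<close> would be a Vietoris-open condition satisfied by \<open>S\<close>. It would
  persist for a finite subset of \<open>S\<close> containing \<open>s\<close>, against
  \<open>finite_min\<close>.\<close>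

lemma closed_min:
  assumes S: "closedin Z S" "s \<in> S"
  shows "\<not> selection_less f s (f S)"
proof
  assume less: "selection_less f s (f S)"
  have S': "S \<subseteq> topspace Z"
    using S closedin_subset by blast
  have fS: "f S \<in> S"
    using S sel_in by blast
  define W where "W = {T \<in> topspace (vietoris_topology Z). f T \<in> {y \<in> topspace Z. selection_less f s y}}"
  have "openin (vietoris_topology Z) W"
    unfolding W_def
    using sel open_upper S S' openin_continuous_map_preimage
    unfolding continuous_selection_def by blast
  moreover have "S \<in> W"
    using S S' fS less by (auto simp: W_def nonempty_closed_sets_def)
  ultimately obtain F where F: "finite F" "F \<subseteq> S"
    "\<And>T. \<lbrakk>T \<in> nonempty_closed_sets Z; F \<subseteq> T; T \<subseteq> S\<rbrakk> \<Longrightarrow> T \<in> W"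
    by (rule vietoris_open_finite_core) auto
  have "closedin Z (insert s F)"
    using F S S' by (intro finite_closed) auto
  then have "insert s F \<in> W"
    using F S by (intro F(3)) (auto simp: nonempty_closed_sets_def)
  then show False
    using finite_min[of "insert s F" s] F S S' by (auto simp: W_def)
qed

end

subsection \<open>Minima of closed sets and the order topology\<close>

lemma openin_vietoris_subset:
  assumes "openin Z U"
  shows "openin (vietoris_topology Z) {S \<in> nonempty_closed_sets Z. S \<subseteq> U}"
proof -
  have "{S \<in> nonempty_closed_sets Z. S \<subseteq> U} = vietoris_basic Z {U}"
    by (auto simp: vietoris_basic_def nonempty_closed_sets_def)
  then show ?thesis
    using openin_vietoris_basic[of "{U}" Z] assms by simp
qed

lemma openin_vietoris_meets:
  assumes "openin Z U"
  shows "openin (vietoris_topology Z) {S \<in> nonempty_closed_sets Z. S \<inter> U \<noteq> {}}"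
proof -
  have "{S \<in> nonempty_closed_sets Z. S \<inter> U \<noteq> {}} = vietoris_basic Z {U, topspace Z}"
    by (auto simp: vietoris_basic_def nonempty_closed_sets_def dest: closedin_subset)
  then show ?thesis
    using openin_vietoris_basic[of "{U, topspace Z}" Z] assms by auto
qed

lemma closedin_insert_point:
  assumes "t1_space X" "p \<in> topspace X" "closedin (subtopology X (topspace X - {p})) S"
  shows "closedin X (insert p S)"
proof -
  have "closedin X {p}"
    using assms t1_space_closedin_singleton by metis
  moreover obtain C where C: "closedin X C" "S = C \<inter> (topspace X - {p})"
    using assms(3) unfolding closedin_subtopology by blast
  moreover have "insert p S = C \<union> {p}"
    using C closedin_subset by blast
  ultimately show ?thesis
    by (metis closedin_Un)
qed

lemma openin_delete_point: "\<lbrakk>t1_space X; p \<in> topspace X\<rbrakk> \<Longrightarrow> openin X (topspace X - {p})"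
  by (simp add: openin_diff t1_space_closedin_singleton)

lemma ordered_connected_open_interval:
  assumes "connected_space X" "linear_order_on (topspace X) r"
    and X: "X = open_interval_topology (topspace X) r"
  shows "ordered_connected X (\<lambda>x y. (x, y) \<in> r \<and> x \<noteq> y)"
proof
  have r: "refl_on (topspace X) r" "trans r" "antisym r" "total_on (topspace X) r"
    using assms(2) by (auto simp: order_on_defs)
  show "(x, z) \<in> r \<and> x \<noteq> z" if "(x, y) \<in> r \<and> x \<noteq> y" "(y, z) \<in> r \<and> y \<noteq> z" for x y z
    using that r(2,3) by (metis antisymD transD)
  show "(x, y) \<in> r \<and> x \<noteq> y \<or> x = y \<or> (y, x) \<in> r \<and> y \<noteq> x"
    if "x \<in> topspace X" "y \<in> topspace X" for x y
    using that r(4) by (auto simp: total_on_def)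
  show "openin X {y \<in> topspace X. (y, x) \<in> r \<and> y \<noteq> x}" if "x \<in> topspace X" for x
    by (subst X, unfold open_interval_topology_def, rule topology_generated_by_Basis)
      (use that in auto)
  show "openin X {y \<in> topspace X. (x, y) \<in> r \<and> x \<noteq> y}" if "x \<in> topspace X" for x
    by (subst X, unfold open_interval_topology_def, rule topology_generated_by_Basis)
      (use that in auto)
qed (use assms in auto)

text \<open>\<open>D - {q}\<close> is relatively closed in \<open>X - {q}\<close>, so the selection
  restricts to it. The point \<open>q\<close> may lie outside \<open>D\<close>, which then is
  treated whole, and \<open>D\<close> may be all of \<open>X\<close>.\<close>

lemma connected_selection_subspace:
  assumes haus: "Hausdorff_space X"
    and f: "continuous_selection (subtopology X (topspace X - {q})) f"
    and D: "closedin X D" "connectedin X (D - {q})"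
  shows "connected_selection (subtopology X (D - {q})) f"
proof
  let ?Y = "subtopology X (topspace X - {q})"
  have eq: "D - {q} = D \<inter> (topspace X - {q})"
    using closedin_subset[OF D(1)] by blast
  then have "closedin ?Y (D - {q})"
    using D(1) unfolding closedin_subtopology by blast
  then have "continuous_selection (subtopology ?Y (D - {q})) f"
    by (rule continuous_selection_closed_subspace[OF f])
  then show "continuous_selection (subtopology X (D - {q})) f"
    using eq by (simp add: subtopology_subtopology Int_left_commute Int_absorb1 inf_commute)
qed (use haus D(2) in \<open>auto simp: connectedin_def Hausdorff_space_subtopology\<close>)

section \<open>Extrema of closed sets, compactness and orderability\<close>

context ordered_connected
begin

text \<open>Without a least element, the open upper rays at points of \<open>S\<close> cover
  \<open>S\<close>. A finite subcover fails at the least of its finitely many endpoints.\<close>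

lemma compact_closed_min:
  assumes "compact_space Z" "closedin Z S" "S \<noteq> {}"
  shows "\<exists>m\<in>S. \<forall>s\<in>S. \<not> s \<sqsubset> m"
proof (rule ccontr)
  assume no_min: "\<not> ?thesis"
  have SZ: "S \<subseteq> topspace Z"
    using assms(2) closedin_subset by blast
  let ?R = "\<lambda>s. {y \<in> topspace Z. s \<sqsubset> y}"
  have "compactin Z S"
    using assms closedin_compact_space by blast
  moreover have "S \<subseteq> \<Union>(?R ` S)"
    using no_min SZ by auto
  moreover have "\<And>U. U \<in> ?R ` S \<Longrightarrow> openin Z U"
    using open_upper SZ by blast
  ultimately obtain \<F> where \<F>: "finite \<F>" "\<F> \<subseteq> ?R ` S" "S \<subseteq> \<Union>\<F>"
    unfolding compactin_def by meson
  then obtain T where T: "finite T" "T \<subseteq> S" "\<F> = ?R ` T"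
    by (meson finite_subset_image)
  have "T \<noteq> {}"
    using \<F>(3) T(3) assms(3) by auto
  then obtain t where t: "t \<in> T" "\<And>s. s \<in> T \<Longrightarrow> \<not> s \<sqsubset> t"
    using ordered_connected.finite_max[OF dual] T SZ by (metis subset_trans)
  then have "t \<in> \<Union>\<F>"
    using T \<F>(3) by blast
  then show False
    using T(3) t(2) by auto
qed

text \<open>The points whose closed initial segment is finitely covered form a clopen set
  \<open>K\<close>. It contains the least point of \<open>Z\<close>, so by connectedness it contains
  the greatest, whose initial segment is all of \<open>Z\<close>.\<close>

lemma closed_min_max_imp_compact:
  assumes min: "\<And>S. \<lbrakk>closedin Z S; S \<noteq> {}\<rbrakk> \<Longrightarrow> \<exists>m\<in>S. \<forall>s\<in>S. \<not> s \<sqsubset> m"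
    and max: "\<And>S. \<lbrakk>closedin Z S; S \<noteq> {}\<rbrakk> \<Longrightarrow> \<exists>m\<in>S. \<forall>s\<in>S. \<not> m \<sqsubset> s"
  shows "compact_space Z"
  unfolding compact_space_def compactin_def
proof (intro conjI allI impI subset_refl)
  fix \<U> assume \<U>: "Ball \<U> (openin Z) \<and> topspace Z \<subseteq> \<Union>\<U>"
  let ?le = "\<lambda>x. {y \<in> topspace Z. \<not> x \<sqsubset> y}"
  define covered where "covered A \<longleftrightarrow> (\<exists>\<F>. finite \<F> \<and> \<F> \<subseteq> \<U> \<and> A \<subseteq> \<Union>\<F>)" for A
  have covered_empty: "covered {}"
    unfolding covered_def by (rule exI[of _ "{}"]) simp
  have covered_extend: "covered B" if A: "covered A" and "U \<in> \<U>" "B \<subseteq> A \<union> U" for A B U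
  proof -
    obtain \<F> where "finite \<F>" "\<F> \<subseteq> \<U>" "A \<subseteq> \<Union>\<F>"
      using A unfolding covered_def by blast
    then show ?thesis
      unfolding covered_def using that(2,3) by (intro exI[of _ "insert U \<F>"]) auto
  qed
  define K where "K = {x \<in> topspace Z. covered (?le x)}"
  have nbhd: "\<exists>U\<in>\<U>. x \<in> U \<and> openin Z U" if "x \<in> topspace Z" for x
    using \<U> that by blast
  have K_extend: "z \<in> K"
    if "x \<in> K" "z \<in> topspace Z" "U \<in> \<U>" "\<And>y. \<lbrakk>y \<in> topspace Z; x \<sqsubset> y; \<not> z \<sqsubset> y\<rbrakk> \<Longrightarrow> y \<in> U" for x z U
    using covered_extend[of "?le x" U "?le z"] that unfolding K_def by auto
  have "openin Z K"
  proof (subst openin_subopen, intro ballI)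
    fix x assume x: "x \<in> K"
    then have xZ: "x \<in> topspace Z" by (simp add: K_def)
    then obtain U where U: "U \<in> \<U>" "x \<in> U" "openin Z U"
      using nbhd by blast
    \<comment> \<open>\<open>S\<close> is what \<open>U\<close> fails to cover from \<open>x\<close>
      on. Points before the least element of \<open>S\<close> are reached by adding \<open>U\<close>
      to the cover up to \<open>x\<close>; if \<open>S\<close> is empty, every point is.\<close>
    define S where "S = {y \<in> topspace Z. \<not> y \<sqsubset> x} \<inter> (topspace Z - U)"
    have "closedin Z S"
      unfolding S_def using closed_upper xZ U by blast
    show "\<exists>T. openin Z T \<and> x \<in> T \<and> T \<subseteq> K"
    proof (cases "S = {}")
      case True
      have "z \<in> K" if "z \<in> topspace Z" for z
        by (rule K_extend[OF x that U(1)]) (use True asym xZ in \<open>auto simp: S_def\<close>)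
      then show ?thesis
        using xZ openin_topspace by blast
    next
      case False
      then obtain s where s: "s \<in> S" "\<And>y. y \<in> S \<Longrightarrow> \<not> y \<sqsubset> s"
        using min[OF \<open>closedin Z S\<close> False] by blast
      then have sZ: "s \<in> topspace Z" "x \<sqsubset> s"
        using total[of x s] xZ U by (auto simp: S_def)
      have "z \<in> K" if z: "z \<in> topspace Z" "z \<sqsubset> s" for z
      proof (rule K_extend[OF x z(1) U(1)])
        fix y assume y: "y \<in> topspace Z" "x \<sqsubset> y" "\<not> z \<sqsubset> y"
        then have "y \<sqsubset> s"
          using total[of y z] trans[of y z s] z sZ by blast
        then have "y \<notin> S"
          using s(2) by blast
        then show "y \<in> U"
          using y asym xZ by (auto simp: S_def)
      qed
      then have "{z \<in> topspace Z. z \<sqsubset> s} \<subseteq> K"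
        by blast
      then show ?thesis
        using open_lower sZ xZ by blast
    qed
  qed
  moreover have "closedin Z K"
  proof -
    have "openin Z (topspace Z - K)"
    proof (subst openin_subopen, intro ballI)
      fix x assume x: "x \<in> topspace Z - K"
      then obtain U where U: "U \<in> \<U>" "x \<in> U" "openin Z U"
        using nbhd by blast
      \<comment> \<open>Dually, let \<open>s\<close> be the greatest point up to \<open>x\<close>
        outside \<open>U\<close>. A point of \<open>K\<close> beyond \<open>s\<close> would put
        \<open>x\<close> into \<open>K\<close> by adding \<open>U\<close>, so the ray above
        \<open>s\<close> avoids \<open>K\<close>.\<close>
      define S where "S = {y \<in> topspace Z. \<not> x \<sqsubset> y} \<inter> (topspace Z - U)"
      have "closedin Z S"
        unfolding S_def using closed_lower x U by blast
      moreover have "S \<noteq> {}"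
      proof
        assume "S = {}"
        then have "?le x \<subseteq> {} \<union> U"
          by (auto simp: S_def)
        then have "x \<in> K"
          using covered_extend[OF covered_empty U(1)] x unfolding K_def by blast
        then show False using x by blast
      qed
      ultimately obtain s where s: "s \<in> S" "\<And>y. y \<in> S \<Longrightarrow> \<not> s \<sqsubset> y"
        using max[of S] by blast
      then have sZ: "s \<in> topspace Z" "s \<sqsubset> x"
        using total[of x s] x U by (auto simp: S_def)
      have "z \<notin> K" if z: "z \<in> topspace Z" "s \<sqsubset> z" for z
      proof
        assume "z \<in> K"
        then have "x \<in> K"
        proof (rule K_extend[OF _ _ U(1)])
          fix y assume y: "y \<in> topspace Z" "z \<sqsubset> y" "\<not> x \<sqsubset> y"
          then have "y \<notin> S"
            using s(2) trans[of s z y] z sZ by blast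
          then show "y \<in> U"
            using y by (auto simp: S_def)
        qed (use x in blast)
        then show False using x by blast
      qed
      then have "{z \<in> topspace Z. s \<sqsubset> z} \<subseteq> topspace Z - K"
        by blast
      then show "\<exists>T. openin Z T \<and> x \<in> T \<and> T \<subseteq> topspace Z - K"
        using open_upper sZ x by blast
    qed
    then show ?thesis
      by (auto simp: closedin_def K_def)
  qed
  ultimately have K: "K = {} \<or> K = topspace Z"
    using conn unfolding connected_space_clopen_in by blast
  show "\<exists>\<F>. finite \<F> \<and> \<F> \<subseteq> \<U> \<and> topspace Z \<subseteq> \<Union>\<F>"
  proof (cases "topspace Z = {}")
    case True
    then show ?thesis by (intro exI[of _ "{}"]) auto
  next
    case False
    obtain a where a: "a \<in> topspace Z" "\<And>y. y \<in> topspace Z \<Longrightarrow> \<not> y \<sqsubset> a"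
      using min[OF closedin_topspace False] by blast
    obtain b where b: "b \<in> topspace Z" "\<And>y. y \<in> topspace Z \<Longrightarrow> \<not> b \<sqsubset> y"
      using max[OF closedin_topspace False] by blast
    obtain U where U: "U \<in> \<U>" "a \<in> U"
      using nbhd a by blast
    have "?le a \<subseteq> {} \<union> U"
      using a U(2) total by auto
    then have "a \<in> K"
      using covered_extend[OF covered_empty U(1)] a(1) unfolding K_def by blast
    then have "b \<in> K"
      using K b by blast
    moreover have "?le b = topspace Z"
      using b by blast
    ultimately show ?thesis
      unfolding K_def covered_def by simp
  qed
qed

text \<open>Open rays make the order topology coarser than that of \<open>Z\<close>. Conversely,
  around a point \<open>x\<close> of an open \<open>U\<close>, the least point above
  \<open>x\<close> outside \<open>U\<close> and the greatest such point below bound an order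
  interval inside \<open>U\<close>; a missing bound is replaced by the whole space.\<close>

lemma closed_min_max_imp_orderable:
  assumes min: "\<And>S. \<lbrakk>closedin Z S; S \<noteq> {}\<rbrakk> \<Longrightarrow> \<exists>m\<in>S. \<forall>s\<in>S. \<not> s \<sqsubset> m"
    and max: "\<And>S. \<lbrakk>closedin Z S; S \<noteq> {}\<rbrakk> \<Longrightarrow> \<exists>m\<in>S. \<forall>s\<in>S. \<not> m \<sqsubset> s"
  shows "orderable_space Z"
proof -
  define r where "r = {(x, y). x \<in> topspace Z \<and> y \<in> topspace Z \<and> (x \<sqsubset> y \<or> x = y)}"
  let ?O = "open_interval_topology (topspace Z) r"
  have "refl_on (topspace Z) r"
    by (auto simp: r_def refl_on_def)
  moreover have "Relation.trans r"
    by (rule transI) (use trans in \<open>auto simp: r_def\<close>)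
  moreover have "antisym r"
    by (rule antisymI) (use asym in \<open>auto simp: r_def\<close>)
  moreover have "total_on (topspace Z) r"
    using total by (auto simp: total_on_def r_def)
  moreover have "r \<subseteq> topspace Z \<times> topspace Z"
    by (auto simp: r_def)
  ultimately have lin: "linear_order_on (topspace Z) r"
    by (simp add: order_on_defs)
  have low: "{y \<in> topspace Z. (y, x) \<in> r \<and> y \<noteq> x} = {y \<in> topspace Z. y \<sqsubset> x}"
    and upp: "{y \<in> topspace Z. (x, y) \<in> r \<and> x \<noteq> y} = {y \<in> topspace Z. x \<sqsubset> y}"
    if "x \<in> topspace Z" for x
    using that irrefl by (auto simp: r_def)
  have O_low: "openin ?O {y \<in> topspace Z. y \<sqsubset> x}" if "x \<in> topspace Z" for x
    unfolding open_interval_topology_def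
    by (rule topology_generated_by_Basis) (use low[OF that] that in blast)
  have O_upp: "openin ?O {y \<in> topspace Z. x \<sqsubset> y}" if "x \<in> topspace Z" for x
    unfolding open_interval_topology_def
    by (rule topology_generated_by_Basis) (use upp[OF that] that in blast)
  have O_top: "openin ?O (topspace Z)"
    using openin_topspace[of ?O] by simp
  have "openin Z U \<longleftrightarrow> openin ?O U" for U
  proof
    assume "openin ?O U"
    then have "generate_topology_on (insert (topspace Z)
        ({{y \<in> topspace Z. (y, x) \<in> r \<and> y \<noteq> x} | x. x \<in> topspace Z} \<union>
         {{y \<in> topspace Z. (x, y) \<in> r \<and> x \<noteq> y} | x. x \<in> topspace Z})) U"
      unfolding open_interval_topology_def by (rule openin_topology_generated_by)
    then show "openin Z U"
    proof induction
      case (Basis s)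
      then show ?case
        using low upp open_lower open_upper by auto
    qed auto
  next
    assume U: "openin Z U"
    show "openin ?O U"
    proof (subst openin_subopen, intro ballI)
      fix x assume x: "x \<in> U"
      then have xZ: "x \<in> topspace Z"
        using U openin_subset by blast
      define A where "A = {y \<in> topspace Z. \<not> y \<sqsubset> x} \<inter> (topspace Z - U)"
      define B where "B = {y \<in> topspace Z. \<not> x \<sqsubset> y} \<inter> (topspace Z - U)"
      have "closedin Z A" "closedin Z B"
        unfolding A_def B_def using closed_upper closed_lower xZ U by blast+
      have "\<exists>T. openin ?O T \<and> x \<in> T \<and> T \<inter> A = {}"
      proof (cases "A = {}")
        case True
        then show ?thesis using O_top xZ by blast
      next
        case False
        then obtain s where s: "s \<in> A" "\<And>y. y \<in> A \<Longrightarrow> \<not> y \<sqsubset> s"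
          using min[OF \<open>closedin Z A\<close> False] by blast
        then have "s \<in> topspace Z" "x \<sqsubset> s"
          using total[of x s] xZ x by (auto simp: A_def)
        then show ?thesis
          using O_low[of s] s(2) xZ by blast
      qed
      then obtain T1 where T1: "openin ?O T1" "x \<in> T1" "T1 \<inter> A = {}"
        by blast
      have "\<exists>T. openin ?O T \<and> x \<in> T \<and> T \<inter> B = {}"
      proof (cases "B = {}")
        case True
        then show ?thesis using O_top xZ by blast
      next
        case False
        then obtain s where s: "s \<in> B" "\<And>y. y \<in> B \<Longrightarrow> \<not> s \<sqsubset> y"
          using max[OF \<open>closedin Z B\<close> False] by blast
        then have "s \<in> topspace Z" "s \<sqsubset> x"
          using total[of x s] xZ x by (auto simp: B_def)
        then show ?thesis
          using O_upp[of s] s(2) xZ by blast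
      qed
      then obtain T2 where T2: "openin ?O T2" "x \<in> T2" "T2 \<inter> B = {}"
        by blast
      have "T1 \<inter> T2 \<subseteq> U"
      proof
        fix y assume y: "y \<in> T1 \<inter> T2"
        then have "y \<in> topspace Z" "y \<notin> A" "y \<notin> B"
          using T1 T2 openin_subset[OF T1(1)] by auto
        then show "y \<in> U"
          using asym xZ by (auto simp: A_def B_def)
      qed
      then show "\<exists>T. openin ?O T \<and> x \<in> T \<and> T \<subseteq> U"
        using T1 T2 by blast
    qed
  qed
  then have "Z = ?O"
    by (simp add: topology_eq)
  then show ?thesis
    unfolding orderable_space_def using lin by blast
qed

text \<open>Pick \<open>q\<close> above some point of \<open>S\<close> and below \<open>b\<close>.
  The selection on \<open>Z - {q}\<close> restricts to the connected lower ray \<open>C\<close> at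
  \<open>q\<close> and finds the minimum of the trace of \<open>S\<close> there, provided its order
  is the given one and not the reverse. Maxima follow by applying this to the reversed
  order.\<close>

lemma closed_min_of_selections:
  assumes haus: "Hausdorff_space Z"
    and a: "a \<in> topspace Z" "\<And>x. x \<in> topspace Z \<Longrightarrow> \<not> x \<sqsubset> a"
    and b: "b \<in> topspace Z" "\<And>x. x \<in> topspace Z \<Longrightarrow> \<not> b \<sqsubset> x"
    and sel: "\<And>q. q \<in> topspace Z \<Longrightarrow>
      \<exists>f. continuous_selection (subtopology Z (topspace Z - {q})) f"
    and S: "closedin Z S" "S \<noteq> {}"
  shows "\<exists>m\<in>S. \<forall>s\<in>S. \<not> s \<sqsubset> m"
proof (cases "S = {b}")
  case True
  then show ?thesis using b irrefl by simp
next
  case False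
  have SZ: "S \<subseteq> topspace Z"
    using S closedin_subset by blast
  then obtain s where s: "s \<in> S" "s \<in> topspace Z" "s \<noteq> b"
    using False S(2) by blast
  then have "s \<sqsubset> b"
    using total b by blast
  then obtain q where q: "q \<in> topspace Z" "s \<sqsubset> q" "q \<sqsubset> b"
    using dense s b by blast
  define C where "C = {y \<in> topspace Z. y \<sqsubset> q}"
  obtain f where f: "continuous_selection (subtopology Z (topspace Z - {q})) f"
    using sel q by blast
  have conC: "connectedin Z C"
    unfolding C_def using connectedin_lower q by blast
  have topC: "topspace (subtopology Z C) = C"
    by (auto simp: C_def)
  \<comment> \<open>Written as a closed set minus \<open>q\<close>, the ray fits
    \<open>connected_selection_subspace\<close>.\<close>
  have "C = {y \<in> topspace Z. \<not> q \<sqsubset> y} - {q}"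
    using total asym irrefl q by (auto simp: C_def)
  then interpret f: connected_selection "subtopology Z C" f
    using connected_selection_subspace[OF haus f closed_lower[OF q(1)]] conC by simp
  have sC: "s \<in> C"
    using s q by (simp add: C_def)
  have "(\<forall>x\<in>C. \<forall>y\<in>C. x \<sqsubset> y \<longleftrightarrow> selection_less f x y) \<or>
        (\<forall>x\<in>C. \<forall>y\<in>C. x \<sqsubset> y \<longleftrightarrow> selection_less f y x)"
    using ordered_connected_unique[OF restrict[OF conC] f.ordered_connected_axioms]
    unfolding topC .
  \<comment> \<open>With the reverse order, \<open>f C\<close> would be the greatest point of
    \<open>C\<close>, but density gives another point between it and \<open>q\<close>.\<close>
  moreover have "\<not> (\<forall>x\<in>C. \<forall>y\<in>C. x \<sqsubset> y \<longleftrightarrow> selection_less f y x)"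
  proof
    assume rev: "\<forall>x\<in>C. \<forall>y\<in>C. x \<sqsubset> y \<longleftrightarrow> selection_less f y x"
    have cl: "closedin (subtopology Z C) C"
      using closedin_topspace[of "subtopology Z C"] topC by simp
    then have "f C \<in> C"
      using f.sel_in sC by blast
    then obtain z where z: "z \<in> topspace Z" "f C \<sqsubset> z" "z \<sqsubset> q"
      using dense[of "f C" q] q by (auto simp: C_def)
    then have "z \<in> C"
      by (simp add: C_def)
    then have "selection_less f z (f C)"
      using rev \<open>f C \<in> C\<close> z(2) by blast
    then show False
      using f.closed_min[OF cl \<open>z \<in> C\<close>] by blast
  qed
  ultimately have agree: "\<And>x y. \<lbrakk>x \<in> C; y \<in> C\<rbrakk> \<Longrightarrow> x \<sqsubset> y \<longleftrightarrow> selection_less f x y"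
    by blast
  let ?m = "f (S \<inter> C)"
  have cl: "closedin (subtopology Z C) (S \<inter> C)"
    using S(1) closedin_subtopology by blast
  then have m: "?m \<in> S" "?m \<in> C"
    using f.sel_in s(1) sC by blast+
  have "\<not> x \<sqsubset> ?m" if x: "x \<in> S" for x
  proof (cases "x \<in> C")
    case True
    then show ?thesis
      using agree m(2) x f.closed_min[OF cl] by blast
  next
    case False
    then show ?thesis
      using x SZ m(2) trans[of x ?m q] q by (auto simp: C_def)
  qed
  then show ?thesis
    using m(1) by blast
qed

end

section \<open>Selections on punctured compact ordered spaces\<close>

lemma compact_orderable_selection:
  assumes con: "connected_space X" and "Hausdorff_space X"
    and comp: "compact_space X" and "orderable_space X" and p: "p \<in> topspace X"
  shows "\<exists>f. continuous_selection (subtopology X (topspace X - {p})) f"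
proof -
  obtain r where r: "linear_order_on (topspace X) r" "X = open_interval_topology (topspace X) r"
    using assms unfolding orderable_space_def by blast
  define lt where "lt x y \<longleftrightarrow> (x, y) \<in> r \<and> x \<noteq> y" for x y
  interpret o: ordered_connected X lt
    using ordered_connected_open_interval[OF con r] unfolding lt_def .
  let ?Z = "subtopology X (topspace X - {p})"
  let ?V = "vietoris_topology ?Z"
  have t1: "t1_space X"
    using assms Hausdorff_imp_t1_space by blast
  have topZ: "topspace ?Z = topspace X - {p}"
    by auto
  define mn where "mn S = (SOME m. m \<in> S \<and> (\<forall>s\<in>S. \<not> lt s m))" for S
  define mx where "mx S = (SOME m. m \<in> S \<and> (\<forall>s\<in>S. \<not> lt m s))" for S
  have mn: "mn S \<in> S \<and> (\<forall>s\<in>S. \<not> lt s (mn S))" if "closedin X S" "S \<noteq> {}" for S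
  proof -
    have "\<exists>m. m \<in> S \<and> (\<forall>s\<in>S. \<not> lt s m)"
      using o.compact_closed_min[OF comp that] by blast
    from someI_ex[OF this] show ?thesis
      unfolding mn_def .
  qed
  have mx: "mx S \<in> S \<and> (\<forall>s\<in>S. \<not> lt (mx S) s)" if "closedin X S" "S \<noteq> {}" for S
  proof -
    have "\<exists>m. m \<in> S \<and> (\<forall>s\<in>S. \<not> lt m s)"
      using ordered_connected.compact_closed_min[OF o.dual comp that] by blast
    from someI_ex[OF this] show ?thesis
      unfolding mx_def .
  qed
  define L where "L q = {y \<in> topspace X - {p}. lt y q}" for q
  define R where "R q = {y \<in> topspace X - {p}. lt q y}" for q
  \<comment> \<open>A closed subset of \<open>X - {p}\<close> becomes closed in \<open>X\<close>
    once \<open>p\<close> is added, so extrema exist. The added point is never selected: the minimum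
    is below \<open>p\<close> when \<open>S\<close> meets \<open>L p\<close>, and otherwise the
    maximum is above \<open>p\<close>.\<close>
  define f where "f S = (if S \<inter> L p \<noteq> {} then mn (insert p S) else mx (insert p S))" for S
  have openLR: "openin ?Z (L q)" "openin ?Z (R q)" if "q \<in> topspace X" for q
  proof -
    have "L q = {y \<in> topspace X. lt y q} \<inter> (topspace X - {p})"
      "R q = {y \<in> topspace X. lt q y} \<inter> (topspace X - {p})"
      by (auto simp: L_def R_def)
    then show "openin ?Z (L q)" "openin ?Z (R q)"
      using o.open_lower[OF that] o.open_upper[OF that] unfolding openin_subtopology by blast+
  qed
  have S_sub: "S \<subseteq> topspace X - {p}" "S \<noteq> {}" if "S \<in> nonempty_closed_sets ?Z" for S
    using that closedin_subset topZ unfolding nonempty_closed_sets_def by blast+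
  have S_closed: "closedin X (insert p S)" if "S \<in> nonempty_closed_sets ?Z" for S
    using that closedin_insert_point[OF t1 p] by (simp add: nonempty_closed_sets_def)
  have f_low: "f S \<in> S \<and> (\<forall>s\<in>S. \<not> lt s (f S))"
    if S: "S \<in> nonempty_closed_sets ?Z" and meets: "S \<inter> L p \<noteq> {}" for S
  proof -
    have fS: "f S = mn (insert p S)"
      using meets by (simp add: f_def)
    have m: "mn (insert p S) \<in> insert p S" "\<forall>s\<in>insert p S. \<not> lt s (mn (insert p S))"
      using mn[OF S_closed[OF S]] by auto
    moreover have "mn (insert p S) \<noteq> p"
      using m(2) meets by (auto simp: L_def)
    ultimately show ?thesis
      unfolding fS by auto
  qed
  have f_upp: "f S \<in> S \<and> (\<forall>s\<in>S. \<not> lt (f S) s)"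
    if S: "S \<in> nonempty_closed_sets ?Z" and above: "S \<inter> L p = {}" for S
  proof -
    have fS: "f S = mx (insert p S)"
      using above by (simp add: f_def)
    have m: "mx (insert p S) \<in> insert p S" "\<forall>s\<in>insert p S. \<not> lt (mx (insert p S)) s"
      using mx[OF S_closed[OF S]] by auto
    obtain s where "s \<in> S" "s \<in> topspace X" "s \<noteq> p" "\<not> lt s p"
      using S_sub[OF S] above by (auto simp: L_def)
    then have "s \<in> S" "lt p s"
      using o.total p by auto
    then have "mx (insert p S) \<noteq> p"
      using m(2) by auto
    then show ?thesis
      unfolding fS using m by auto
  qed
  \<comment> \<open>Both cases in the definition of \<open>f\<close> are thereby Vietoris-open:
    meeting \<open>L p\<close>, or lying inside \<open>R p\<close>.\<close>
  have L_or_R: "S \<inter> L p = {} \<longleftrightarrow> S \<subseteq> R p" if "S \<in> nonempty_closed_sets ?Z" for S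
    using S_sub[OF that] o.total[OF _ p] o.asym[OF _ _ p] by (auto simp: L_def R_def)
  have f_in: "f S \<in> S" if "S \<in> nonempty_closed_sets ?Z" for S
    using f_low f_upp that by blast
  \<comment> \<open>A minimum is below \<open>q\<close> when some point is, a maximum when all
    points are; the conditions become meeting or lying inside open sets.\<close>
  have f_less: "lt (f S) q \<longleftrightarrow> S \<inter> L p \<noteq> {} \<and> S \<inter> L q \<noteq> {} \<or> S \<subseteq> R p \<and> S \<subseteq> L q"
    if S: "S \<in> nonempty_closed_sets ?Z" and q: "q \<in> topspace X" for S q
  proof -
    have tops: "s \<in> topspace X" "s \<noteq> p" if "s \<in> S" for s
      using S_sub[OF S] that by auto
    show ?thesis
    proof (cases "S \<inter> L p = {}")
      case True
      then have "lt (f S) q \<longleftrightarrow> (\<forall>s\<in>S. lt s q)"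
        using f_upp[OF S True] tops q o.trans o.total by metis
      then show ?thesis
        using True L_or_R[OF S] tops by (auto simp: L_def)
    next
      case False
      then have "lt (f S) q \<longleftrightarrow> (\<exists>s\<in>S. lt s q)"
        using f_low[OF S False] tops q o.trans o.total by metis
      then show ?thesis
        using False L_or_R[OF S] tops by (auto simp: L_def)
    qed
  qed
  have f_greater: "lt q (f S) \<longleftrightarrow> S \<inter> L p \<noteq> {} \<and> S \<subseteq> R q \<or> S \<subseteq> R p \<and> S \<inter> R q \<noteq> {}"
    if S: "S \<in> nonempty_closed_sets ?Z" and q: "q \<in> topspace X" for S q
  proof -
    have tops: "s \<in> topspace X" "s \<noteq> p" if "s \<in> S" for s
      using S_sub[OF S] that by auto
    show ?thesis
    proof (cases "S \<inter> L p = {}")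
      case True
      then have "lt q (f S) \<longleftrightarrow> (\<exists>s\<in>S. lt q s)"
        using f_upp[OF S True] tops q o.trans o.total by metis
      then show ?thesis
        using True L_or_R[OF S] tops by (auto simp: R_def)
    next
      case False
      then have "lt q (f S) \<longleftrightarrow> (\<forall>s\<in>S. lt q s)"
        using f_low[OF S False] tops q o.trans o.total by metis
      then show ?thesis
        using False L_or_R[OF S] tops by (auto simp: R_def)
    qed
  qed
  let ?sub = "\<lambda>U. {S \<in> nonempty_closed_sets ?Z. S \<subseteq> U}"
  let ?meet = "\<lambda>U. {S \<in> nonempty_closed_sets ?Z. S \<inter> U \<noteq> {}}"
  have pre_low: "openin ?V {S \<in> nonempty_closed_sets ?Z. lt (f S) q}" if q: "q \<in> topspace X" for q
  proof -
    have "{S \<in> nonempty_closed_sets ?Z. lt (f S) q} =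
        ?meet (L p) \<inter> ?meet (L q) \<union> ?sub (R p) \<inter> ?sub (L q)"
      using f_less[OF _ q] by blast
    moreover have "openin ?V \<dots>"
      using openLR[OF p] openLR[OF q]
      by (intro openin_Un openin_Int openin_vietoris_subset openin_vietoris_meets)
    ultimately show ?thesis by simp
  qed
  have pre_upp: "openin ?V {S \<in> nonempty_closed_sets ?Z. lt q (f S)}" if q: "q \<in> topspace X" for q
  proof -
    have "{S \<in> nonempty_closed_sets ?Z. lt q (f S)} =
        ?meet (L p) \<inter> ?sub (R q) \<union> ?sub (R p) \<inter> ?meet (R q)"
      using f_greater[OF _ q] by blast
    moreover have "openin ?V \<dots>"
      using openLR[OF p] openLR[OF q]
      by (intro openin_Un openin_Int openin_vietoris_subset openin_vietoris_meets)
    ultimately show ?thesis by simp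
  qed
  have fX: "f S \<in> topspace X - {p}" if "S \<in> nonempty_closed_sets ?Z" for S
    using f_in[OF that] S_sub[OF that] by blast
  have "continuous_map ?V (open_interval_topology (topspace X) r) f"
    unfolding open_interval_topology_def
  proof (rule continuous_on_generated_topo)
    fix U assume "U \<in> insert (topspace X)
        ({{y \<in> topspace X. (y, x) \<in> r \<and> y \<noteq> x} | x. x \<in> topspace X} \<union>
         {{y \<in> topspace X. (x, y) \<in> r \<and> x \<noteq> y} | x. x \<in> topspace X})"
    then consider "U = topspace X"
      | q where "q \<in> topspace X" "U = {y \<in> topspace X. lt y q}"
      | q where "q \<in> topspace X" "U = {y \<in> topspace X. lt q y}"
      unfolding lt_def by blast
    then show "openin ?V (f -` U \<inter> topspace ?V)"
    proof cases
      case 1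
      then have "f -` U \<inter> topspace ?V = topspace ?V"
        using fX by auto
      then show ?thesis
        using openin_topspace[of ?V] by simp
    next
      case 2
      then have "f -` U \<inter> topspace ?V = {S \<in> nonempty_closed_sets ?Z. lt (f S) q}"
        using fX by auto
      then show ?thesis
        using pre_low 2 by simp
    next
      case 3
      then have "f -` U \<inter> topspace ?V = {S \<in> nonempty_closed_sets ?Z. lt q (f S)}"
        using fX by auto
      then show ?thesis
        using pre_upp 3 by simp
    qed
  qed (use fX in auto)
  then have "continuous_map ?V X f"
    using r(2) by simp
  then have "continuous_map ?V ?Z f"
    using fX by (auto simp: continuous_map_in_subtopology)
  then show ?thesis
    using f_in unfolding continuous_selection_def by blast
qed

subsection \<open>Noncut points\<close>

text \<open>It suffices that \<open>p\<close> lies in the closure of \<open>C\<close>. Otherwise a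
  neighbourhood of \<open>p\<close> has only finitely many points, so \<open>{p}\<close> is clopen
  and would be all of the infinite space.\<close>

lemma connectedin_insert_cofinite:
  assumes X: "connected_space X" "t1_space X" "infinite (topspace X)"
    and C: "connectedin X C" "finite (topspace X - C)" and p: "p \<in> topspace X"
  shows "connectedin X (insert p C)"
proof (rule connectedin_intermediate_closure_of[OF C(1)])
  have CX: "C \<subseteq> topspace X"
    using C(1) connectedin_subset_topspace by blast
  have "p \<in> X closure_of C"
    unfolding in_closure_of
  proof (intro conjI allI impI p)
    fix T assume T: "p \<in> T \<and> openin X T"
    show "\<exists>y. y \<in> C \<and> y \<in> T"
    proof (rule ccontr)
      assume "\<not> ?thesis"
      then have sub: "T - {p} \<subseteq> topspace X - C"
        using T openin_subset by blast
      then have "closedin X (T - {p})"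
        using X(2) C(2) unfolding t1_space_closedin_finite by (meson Diff_subset finite_subset subset_trans)
      then have "openin X (T - (T - {p}))"
        using T by blast
      moreover have "T - (T - {p}) = {p}"
        using T by blast
      moreover have "closedin X {p}"
        using X(2) p t1_space_closedin_singleton by metis
      ultimately have "{p} = topspace X"
        using X(1) unfolding connected_space_clopen_in by auto
      then show False
        using X(3) by (metis finite.emptyI finite_insert)
    qed
  qed
  then show "insert p C \<subseteq> X closure_of C"
    using closure_of_subset CX by (metis insert_subset)
qed blast

lemma ordered_connected_subspace:
  assumes "ordered_connected (subtopology X W) lt" "connectedin X D" "D \<subseteq> W"
  shows "ordered_connected (subtopology X D) lt"
proof -
  have "ordered_connected (subtopology (subtopology X W) D) lt"
    using ordered_connected.restrict[OF assms(1)] assms(2,3) by (simp add: connectedin_subtopology)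
  then show ?thesis
    using assms(3) by (simp add: subtopology_subtopology Int_absorb1)
qed

lemma ordered_connected_subspace_unique:
  assumes lt1: "ordered_connected (subtopology X W1) lt1" "D \<subseteq> W1"
    and lt2: "ordered_connected (subtopology X W2) lt2" "D \<subseteq> W2"
    and D: "connectedin X D"
  shows "(\<forall>x\<in>D. \<forall>y\<in>D. lt1 x y \<longleftrightarrow> lt2 x y) \<or> (\<forall>x\<in>D. \<forall>y\<in>D. lt1 x y \<longleftrightarrow> lt2 y x)"
proof -
  have "topspace (subtopology X D) = D"
    using connectedin_subset_topspace[OF D] by auto
  then show ?thesis
    using ordered_connected_unique[OF ordered_connected_subspace[OF lt1(1) D lt1(2)]
        ordered_connected_subspace[OF lt2(1) D lt2(2)]] by simp
qed

text \<open>Assume every point cuts, and let \<open>A\<close> and \<open>B\<close> separate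
  \<open>X - {p}\<close>. A selection orders \<open>A\<close> together with \<open>p\<close>; the
  part \<open>C\<close> on one side of \<open>p\<close> is open and connected, and has a least
  element \<open>m\<close> for the selection on \<open>X - {p}\<close>. Then \<open>X - {m}\<close>
  is the union of two connected sets through \<open>p\<close>: \<open>C - {m}\<close> with
  \<open>p\<close> added, and the complement of \<open>C\<close>.\<close>

lemma exists_noncut_point:
  assumes X: "infinite (topspace X)" "connected_space X" "Hausdorff_space X"
    and sel: "\<And>q. q \<in> topspace X \<Longrightarrow>
      \<exists>f. continuous_selection (subtopology X (topspace X - {q})) f"
  shows "\<exists>p\<in>topspace X. connectedin X (topspace X - {p})"
proof (rule ccontr)
  assume all_cut: "\<not> ?thesis"
  obtain p where p: "p \<in> topspace X"
    using X(1) by (metis ex_in_conv finite.emptyI)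
  let ?S = "topspace X - {p}"
  have S: "openin X ?S"
    using openin_delete_point[OF Hausdorff_imp_t1_space[OF X(3)] p] .
  have "\<not> connectedin X ?S"
    using all_cut p by blast
  then have "\<exists>E1 E2. openin X E1 \<and> openin X E2 \<and> ?S \<subseteq> E1 \<union> E2 \<and>
      E1 \<inter> E2 \<inter> ?S = {} \<and> E1 \<inter> ?S \<noteq> {} \<and> E2 \<inter> ?S \<noteq> {}"
    using Diff_subset[of "topspace X" "{p}"] unfolding connectedin by argo
  then obtain E1 E2 where E: "openin X E1" "openin X E2" "?S \<subseteq> E1 \<union> E2"
    "E1 \<inter> E2 \<inter> ?S = {}" "E1 \<inter> ?S \<noteq> {}" "E2 \<inter> ?S \<noteq> {}"
    by (elim exE conjE)
  define A where "A = E1 \<inter> ?S"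
  define B where "B = E2 \<inter> ?S"
  have AB: "openin X A" "openin X B" "A \<union> B = ?S" "A \<inter> B = {}" "A \<noteq> {}" "B \<noteq> {}"
    unfolding A_def B_def using E S by blast+
  define W where "W = insert p A"
  have "W = topspace X - B"
    using AB(3,4) p by (auto simp: W_def A_def B_def)
  then have W_closed: "closedin X W"
    using AB(2) by blast
  then have W_conn: "connectedin X W"
    using connectedin_insert_open_closed[OF X(2) AB(1) _ p] unfolding W_def by simp
  have WX: "W \<subseteq> topspace X"
    using W_closed closedin_subset by blast
  then have topW: "topspace (subtopology X W) = W"
    by auto
  \<comment> \<open>Any point outside \<open>W\<close> provides a selection on all of
    \<open>W\<close>, including \<open>p\<close>.\<close>
  obtain q where q: "q \<in> B"
    using AB(6) by blast
  then have "q \<in> topspace X" "W - {q} = W"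
    using AB by (auto simp: W_def)
  then obtain f where "connected_selection (subtopology X W) f"
    using connected_selection_subspace[OF X(3) _ W_closed] W_conn sel by metis
  then interpret f: connected_selection "subtopology X W" f .
  obtain a where a: "a \<in> A"
    using AB(5) by blast
  then have "a \<in> W" "p \<in> W" "a \<noteq> p"
    using AB(3) by (auto simp: W_def)
  then have "selection_less f a p \<or> selection_less f p a"
    using f.total topW by blast
  \<comment> \<open>Reverse the order if necessary, so that \<open>a\<close> lies below
    \<open>p\<close>.\<close>
  then obtain lt where "ordered_connected (subtopology X W) lt" "lt a p"
    using f.ordered_connected_axioms f.dual by metis
  then interpret o: ordered_connected "subtopology X W" lt by simp
  define C where "C = {y \<in> W. lt y p}"
  have pC: "p \<notin> C" "a \<in> C" "C \<subseteq> A"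
    using o.irrefl \<open>lt a p\<close> \<open>a \<in> W\<close> topW unfolding C_def W_def by auto
  have C_conn: "connectedin X C"
    using o.connectedin_lower[of p] \<open>p \<in> W\<close> unfolding topW connectedin_subtopology C_def by blast
  have C_open: "openin X C"
  proof -
    have "openin (subtopology X W) C"
      using o.open_lower[of p] \<open>p \<in> W\<close> unfolding topW C_def by blast
    then obtain T where "openin X T" "C = T \<inter> W"
      unfolding openin_subtopology by blast
    then have "C = T \<inter> A" "openin X T"
      using pC by (auto simp: W_def)
    then show ?thesis
      using AB(1) by blast
  qed
  have C_closed: "closedin X (insert p C)"
  proof -
    have "insert p C = {y \<in> W. \<not> lt p y}"
      using o.total[unfolded topW, OF \<open>p \<in> W\<close>] o.asym[unfolded topW] o.irrefl[unfolded topW]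
        \<open>p \<in> W\<close> unfolding C_def by blast
    then have "closedin (subtopology X W) (insert p C)"
      using o.closed_lower[of p] \<open>p \<in> W\<close> unfolding topW by simp
    then show ?thesis
      using W_closed closedin_trans_full by blast
  qed
  have CX: "C \<subseteq> topspace X"
    using C_open openin_subset by blast
  then have topC: "topspace (subtopology X C) = C"
    by auto
  have "insert p C - {p} = C"
    using pC by blast
  \<comment> \<open>The selection on \<open>X - {p}\<close> is now used: \<open>C\<close> is the
    closed set \<open>insert p C\<close> minus \<open>p\<close>, so \<open>C\<close> itself has a
    least element.\<close>
  then obtain g where "connected_selection (subtopology X C) g"
    using connected_selection_subspace[OF X(3) _ C_closed] C_conn sel[OF p] by metis
  then interpret g: connected_selection "subtopology X C" g .
  define m where "m = g C"
  have "closedin (subtopology X C) C"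
    using closedin_topspace[of "subtopology X C"] topC by simp
  then have m: "m \<in> C" "\<And>s. s \<in> C \<Longrightarrow> \<not> selection_less g s m"
    unfolding m_def using g.sel_in g.closed_min pC by blast+
  have "connectedin (subtopology X C) (C - {m})"
    by (rule g.connectedin_convex) (use m topC in auto)
  then have "connectedin X (C - {m})"
    by (simp add: connectedin_subtopology)
  \<comment> \<open>Otherwise a neighbourhood of \<open>p\<close> meets \<open>C\<close> at most in
    \<open>m\<close>. Removing it, except for \<open>m\<close>, from \<open>insert p C\<close> shows
    that \<open>C\<close> is closed, hence clopen.\<close>
  moreover have "p \<in> X closure_of (C - {m})"
    unfolding in_closure_of
  proof (intro conjI allI impI p)
    fix T assume T: "p \<in> T \<and> openin X T"
    show "\<exists>y. y \<in> C - {m} \<and> y \<in> T"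
    proof (rule ccontr)
      assume "\<not> ?thesis"
      then have "C = insert p C - (T - {m})"
        using T m(1) pC(1) by auto
      moreover have "closedin X {m}"
        using X(3) m(1) CX by (meson Hausdorff_imp_t1_space subsetD t1_space_closedin_singleton)
      ultimately have "closedin X C"
        using C_closed T by (metis closedin_diff openin_diff)
      then have "C = {} \<or> C = topspace X"
        using X(2) C_open unfolding connected_space_clopen_in by blast
      then show False
        using pC p by blast
    qed
  qed
  ultimately have "connectedin X (insert p (C - {m}))"
    using connectedin_intermediate_closure_of closure_of_subset CX
    by (metis Diff_subset insert_subset subset_insertI subset_trans)
  moreover have "connectedin X (insert p (topspace X - insert p C))"
  proof (rule connectedin_insert_open_closed[OF X(2) _ _ p])
    have "insert p (topspace X - insert p C) = topspace X - C"
      using p pC by blast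
    then show "closedin X (insert p (topspace X - insert p C))"
      using C_open by (simp add: closedin_diff)
  qed (use C_closed in blast)
  ultimately have "connectedin X (insert p (C - {m}) \<union> insert p (topspace X - insert p C))"
    by (intro connectedin_Un) auto
  moreover have "insert p (C - {m}) \<union> insert p (topspace X - insert p C) = topspace X - {m}"
    using m(1) pC p CX by blast
  ultimately show False
    using all_cut m(1) CX by auto
qed

text \<open>Neither punctured order sees all of \<open>X\<close>, but those of
  \<open>X - {p}\<close> and \<open>X - {m}\<close> share the connected part \<open>D\<close>. The
  first supplies open lower rays and the second open upper rays of an order with \<open>p\<close> on
  top, once \<open>p\<close> is known to lie above \<open>D\<close> in the second.\<close>

lemma order_from_noncut_point:
  assumes X: "infinite (topspace X)" "connected_space X" "Hausdorff_space X"
    and sel: "\<And>q. q \<in> topspace X \<Longrightarrow>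
      \<exists>f. continuous_selection (subtopology X (topspace X - {q})) f"
    and p: "p \<in> topspace X" and noncut: "connectedin X (topspace X - {p})"
  obtains lt m where "ordered_connected X lt" "m \<in> topspace X"
    "\<And>x. x \<in> topspace X \<Longrightarrow> \<not> lt x m" "\<And>x. x \<in> topspace X \<Longrightarrow> \<not> lt p x"
proof -
  have t1: "t1_space X"
    using X(3) Hausdorff_imp_t1_space by blast
  have piece: "\<exists>f. connected_selection (subtopology X (topspace X - {q})) f"
    if "q \<in> topspace X" "connectedin X (topspace X - {q})" for q
    using connected_selection_subspace[OF X(3) _ closedin_topspace] that sel by blast
  let ?Z = "topspace X - {p}"
  have topZ: "topspace (subtopology X ?Z) = ?Z"
    by auto
  obtain f where "connected_selection (subtopology X ?Z) f"
    using piece[OF p noncut] by blast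
  then interpret z: connected_selection "subtopology X ?Z" f .
  let ?lt1 = "selection_less f"
  have infZ: "infinite ?Z"
    using X(1) by simp
  define m where "m = f ?Z"
  have "closedin (subtopology X ?Z) ?Z"
    using closedin_topspace[of "subtopology X ?Z"] topZ by simp
  then have m: "m \<in> ?Z" "\<And>s. s \<in> ?Z \<Longrightarrow> \<not> ?lt1 s m"
    unfolding m_def using z.sel_in z.closed_min infZ by (metis finite.emptyI, blast)
  define D where "D = topspace X - {p, m}"
  have "infinite D"
    using X(1) by (simp add: D_def)
  then obtain d where d: "d \<in> D"
    by (metis ex_in_conv finite.emptyI)
  have m_less: "?lt1 m x" if "x \<in> D" for x
    using z.total[unfolded topZ, of m x] m that by (auto simp: D_def)
  have "connectedin (subtopology X ?Z) D"
    by (rule z.connectedin_convex) (use m topZ in \<open>auto simp: D_def\<close>)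
  then have D_conn: "connectedin X D"
    by (simp add: connectedin_subtopology)
  let ?Y = "topspace X - {m}"
  have Y: "?Y = insert p D"
    using m p by (auto simp: D_def)
  have "connectedin X ?Y"
    unfolding Y
  proof (rule connectedin_insert_cofinite[OF X(2) t1 X(1) D_conn _ p])
    have "topspace X - D \<subseteq> {p, m}" by (auto simp: D_def)
    then show "finite (topspace X - D)"
      using finite_subset by blast
  qed
  then obtain g where "connected_selection (subtopology X ?Y) g"
    using piece[of m] m by blast
  then interpret g: connected_selection "subtopology X ?Y" g .
  have DZ: "D \<subseteq> ?Z" and DY: "D \<subseteq> ?Y"
    by (auto simp: D_def)
  \<comment> \<open>By uniqueness up to reversal on \<open>D\<close>, the order of
    \<open>X - {m}\<close> can be oriented to match \<open>?lt1\<close>.\<close>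
  obtain lt2 where lt2: "ordered_connected (subtopology X ?Y) lt2"
    and agree: "\<And>x y. \<lbrakk>x \<in> D; y \<in> D\<rbrakk> \<Longrightarrow> ?lt1 x y \<longleftrightarrow> lt2 x y"
    using ordered_connected_subspace_unique[OF z.ordered_connected_axioms DZ
        g.ordered_connected_axioms DY D_conn] g.ordered_connected_axioms g.dual by metis
  interpret y: ordered_connected "subtopology X ?Y" lt2 by (rule lt2)
  have topY: "topspace (subtopology X ?Y) = ?Y"
    by auto
  have D_connY: "connectedin (subtopology X ?Y) D"
    using D_conn DY by (simp add: connectedin_subtopology)
  have pY: "p \<in> ?Y" "p \<notin> D"
    using Y by (auto simp: D_def)
  have Y_open: "openin X ?Y" and Z_open: "openin X ?Z"
    using openin_delete_point[OF t1] p m by auto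
  have lower1: "openin X {y \<in> ?Z. ?lt1 y x}" if "x \<in> ?Z" for x
    using z.open_lower[unfolded topZ, OF that] Z_open openin_trans_full by blast
  have lower2: "openin X {y \<in> ?Y. lt2 y x}" and upper2: "openin X {y \<in> ?Y. lt2 x y}" if "x \<in> ?Y" for x
    using y.open_lower[unfolded topY, OF that] y.open_upper[unfolded topY, OF that]
      Y_open openin_trans_full by blast+
  have "lt2 d p \<or> lt2 p d"
    using y.total[unfolded topY, of d p] d pY DY by auto
  then show thesis
  proof
    assume "lt2 d p"
    then have p_max: "lt2 x p" if "x \<in> D" for x
      using y.same_side[OF D_connY _ pY(2) d that] topY pY(1) by blast
    define lt where "lt x y \<longleftrightarrow> x \<noteq> p \<and> (y = p \<or> ?lt1 x y)" for x y
    have "ordered_connected X lt"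
    proof
      show "\<not> lt x x" for x
        by (simp add: lt_def selection_less_def)
      show "lt x z" if "lt x y" "lt y z" "x \<in> topspace X" "y \<in> topspace X" "z \<in> topspace X" for x y z
        using that z.trans[unfolded topZ, of x y z] by (auto simp: lt_def)
      show "lt x y \<or> x = y \<or> lt y x" if "x \<in> topspace X" "y \<in> topspace X" for x y
        using that z.total[unfolded topZ, of x y] by (auto simp: lt_def)
      show "openin X {y \<in> topspace X. lt y x}" if x: "x \<in> topspace X" for x
      proof (cases "x = p")
        case True
        then have "{y \<in> topspace X. lt y x} = ?Z"
          by (auto simp: lt_def)
        then show ?thesis using Z_open by simp
      next
        case False
        then have "{y \<in> topspace X. lt y x} = {y \<in> ?Z. ?lt1 y x}"
          by (auto simp: lt_def)
        then show ?thesis using lower1 x False by simp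
      qed
      show "openin X {y \<in> topspace X. lt x y}" if x: "x \<in> topspace X" for x
      proof -
        consider "x = p" | "x = m" | "x \<in> D"
          using x by (auto simp: D_def)
        then show ?thesis
        proof cases
          case 1
          then have "{y \<in> topspace X. lt x y} = {}"
            by (auto simp: lt_def)
          then show ?thesis by (metis openin_empty)
        next
          case 2
          then have "{y \<in> topspace X. lt x y} = ?Y"
            using m_less m p by (auto simp: lt_def D_def selection_less_def)
          then show ?thesis using Y_open by simp
        next
          case 3
          \<comment> \<open>The upper ray at \<open>x\<close> contains \<open>p\<close> but not
            \<open>m\<close>, so its openness is read off in \<open>X - {m}\<close>.\<close>
          have "lt x y \<longleftrightarrow> lt2 x y" if y: "y \<in> ?Y" for y
            using y agree[OF 3] p_max[OF 3] 3 pY(2) unfolding Y by (auto simp: lt_def)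
          moreover have "\<not> lt x m"
            using 3 m DZ by (auto simp: lt_def)
          ultimately have "{y \<in> topspace X. lt x y} = {y \<in> ?Y. lt2 x y}"
            by auto
          then show ?thesis using upper2 3 DY by auto
        qed
      qed
    qed (rule X(2))
    moreover have "\<not> lt x m" "\<not> lt p x" if "x \<in> topspace X" for x
      using that m by (auto simp: lt_def)
    ultimately show thesis
      using that m(1) by blast
  next
    \<comment> \<open>Here \<open>m\<close> and \<open>p\<close> both sit at the lower end of \<open>D\<close>, which is impossible: either \<open>D\<close> has
      a greatest element \<open>e\<close>, and no point can separate \<open>m\<close> from \<open>p\<close> in \<open>X - {e}\<close>, or \<open>D\<close> has no
      greatest element, and the ray above \<open>d\<close>, being clopen in \<open>X - {d}\<close>, lacks both ends.\<close>
    assume "lt2 p d"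
    then have p_min: "lt2 p x" if "x \<in> D" for x
      using y.same_side'[OF D_connY _ pY(2) d that] topY pY(1) by blast
    show thesis
    proof (cases "\<exists>e\<in>?Z. \<forall>x\<in>?Z. \<not> ?lt1 e x")
      case True
      then obtain e where e: "e \<in> ?Z" "\<And>x. x \<in> ?Z \<Longrightarrow> \<not> ?lt1 e x"
        by blast
      have "e \<noteq> m"
        using m_less[OF d] e(2) d DZ by blast
      let ?V = "topspace X - {e}"
      have topV: "topspace (subtopology X ?V) = ?V"
        by auto
      have eD: "e \<in> D"
        using e \<open>e \<noteq> m\<close> by (auto simp: D_def)
      have "connectedin (subtopology X ?Z) (topspace X - {p, e})"
        by (rule z.connectedin_convex) (use e topZ in auto)
      then have "connectedin X (topspace X - {p, e})"
        by (simp add: connectedin_subtopology)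
      then have "connectedin X (insert p (topspace X - {p, e}))"
      proof (rule connectedin_insert_cofinite[OF X(2) t1 X(1) _ _ p])
        have "topspace X - (topspace X - {p, e}) \<subseteq> {p, e}" by auto
        then show "finite (topspace X - (topspace X - {p, e}))"
          using finite_subset by blast
      qed
      moreover have "insert p (topspace X - {p, e}) = ?V"
        using e p by auto
      ultimately obtain h where "connected_selection (subtopology X ?V) h"
        using piece[of e] e by auto
      then interpret v: connected_selection "subtopology X ?V" h .
      have mp: "m \<in> ?V" "p \<in> ?V" "m \<noteq> p"
        using m e p \<open>e \<noteq> m\<close> by auto
      then obtain lt3 where lt3: "ordered_connected (subtopology X ?V) lt3" "lt3 m p"
        using v.total[unfolded topV, of m p] v.ordered_connected_axioms v.dual by metis
      interpret w: ordered_connected "subtopology X ?V" lt3 by (rule lt3)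
      obtain r where r: "r \<in> ?V" "lt3 m r" "lt3 r p"
        using w.dense[unfolded topV] mp lt3(2) by blast
      then have "r \<noteq> m" "r \<noteq> p"
        using w.irrefl[unfolded topV] by auto
      then have rD: "r \<in> D"
        using r(1) by (auto simp: D_def)
      \<comment> \<open>The lower rays at \<open>r\<close> in \<open>X - {p}\<close> and
        \<open>X - {m}\<close> contain \<open>m\<close> and \<open>p\<close> respectively and share
        the point \<open>s\<close>. Their union is a connected subset of \<open>X - {e}\<close> that
        avoids \<open>r\<close>, so \<open>r\<close> cannot lie between \<open>m\<close> and
        \<open>p\<close>.\<close>
      define C1 where "C1 = {y \<in> ?Z. ?lt1 y r}"
      define C2 where "C2 = {y \<in> ?Y. lt2 y r}"
      obtain s where s: "s \<in> ?Z" "?lt1 m s" "?lt1 s r"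
        using z.dense[unfolded topZ] m(1) m_less[OF rD] rD DZ by blast
      then have "s \<in> D"
        by (auto simp: D_def selection_less_def)
      have "connectedin X C1"
        using z.connectedin_lower[unfolded topZ connectedin_subtopology] rD DZ unfolding C1_def by blast
      moreover have "connectedin X C2"
        using y.connectedin_lower[unfolded topY connectedin_subtopology] rD DY unfolding C2_def by blast
      moreover have "s \<in> C1 \<inter> C2"
        using s \<open>s \<in> D\<close> agree rD DY by (auto simp: C1_def C2_def)
      ultimately have "connectedin X (C1 \<union> C2)"
        by (intro connectedin_Un) auto
      moreover have "e \<notin> C1" "e \<notin> C2"
        using e rD DZ agree[OF eD rD] by (auto simp: C1_def C2_def)
      then have "C1 \<union> C2 \<subseteq> ?V"
        by (auto simp: C1_def C2_def)
      ultimately have "connectedin (subtopology X ?V) (C1 \<union> C2)"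
        by (simp add: connectedin_subtopology)
      moreover have "r \<notin> C1 \<union> C2"
        using y.irrefl[unfolded topY, of r] rD DY by (auto simp: C1_def C2_def selection_less_def)
      moreover have "m \<in> C1 \<union> C2" "p \<in> C1 \<union> C2"
        using m(1) m_less[OF rD] pY(1) p_min[OF rD] by (auto simp: C1_def C2_def)
      ultimately have "lt3 p r"
        using w.same_side[unfolded topV] r by blast
      then show thesis
        using w.asym[unfolded topV] r mp by blast
    next
      case False
      define R where "R = {y \<in> ?Z. ?lt1 d y}"
      have dZ: "d \<in> ?Z"
        using d DZ by blast
      have R_conn: "connectedin X R"
        using z.connectedin_upper[unfolded topZ connectedin_subtopology, OF dZ] unfolding R_def by blast
      have "d \<notin> R"
        by (simp add: R_def selection_less_def)
      have RD: "R \<subseteq> D"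
        using m(2)[OF dZ] by (auto simp: R_def D_def)
      \<comment> \<open>The lower ray in \<open>X - {m}\<close> contributes the point
        \<open>p\<close>, which lies below \<open>d\<close> there. This makes the complement of
        \<open>insert d R\<close> open in \<open>X\<close>.\<close>
      have "insert d R = topspace X - ({y \<in> ?Z. ?lt1 y d} \<union> {y \<in> ?Y. lt2 y d})"
      proof (intro set_eqI iffI)
        fix x assume x: "x \<in> insert d R"
        then have "x \<in> D" "\<not> ?lt1 x d"
          using d RD z.asym[unfolded topZ, of d x] dZ z.irrefl[unfolded topZ]
          by (auto simp: R_def)
        then show "x \<in> topspace X - ({y \<in> ?Z. ?lt1 y d} \<union> {y \<in> ?Y. lt2 y d})"
          using agree d DZ by auto
      next
        fix x assume x: "x \<in> topspace X - ({y \<in> ?Z. ?lt1 y d} \<union> {y \<in> ?Y. lt2 y d})"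
        then have "x \<noteq> p"
          using p_min[OF d] pY(1) by auto
        then show "x \<in> insert d R"
          using x z.total[unfolded topZ, of x d] dZ by (auto simp: R_def)
      qed
      moreover have "openin X ({y \<in> ?Z. ?lt1 y d} \<union> {y \<in> ?Y. lt2 y d})"
        using lower1[OF dZ] lower2[of d] d DY by blast
      ultimately have "closedin X (insert d R)"
        by (simp add: closedin_diff)
      moreover have "insert d R - {d} = R" "d \<in> topspace X"
        using \<open>d \<notin> R\<close> dZ by auto
      ultimately obtain h where "connected_selection (subtopology X R) h"
        using connected_selection_subspace[OF X(3)] R_conn sel by metis
      then interpret h: connected_selection "subtopology X R" h .
      have topR: "topspace (subtopology X R) = R"
        by (auto simp: R_def)
      then have "closedin (subtopology X R) R"
        using closedin_topspace[of "subtopology X R"] by simp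
      moreover have "R \<noteq> {}"
        using False dZ by (auto simp: R_def)
      ultimately have n: "h R \<in> R" "\<And>s. s \<in> R \<Longrightarrow> \<not> selection_less h s (h R)"
        using h.sel_in h.closed_min by blast+
      have RZ: "R \<subseteq> ?Z"
        by (auto simp: R_def)
      have "h R \<in> ?Z" "?lt1 d (h R)"
        using n(1) by (auto simp: R_def)
      then obtain s where s: "s \<in> ?Z" "?lt1 d s" "?lt1 s (h R)"
        using z.dense[unfolded topZ] dZ by blast
      obtain t where t: "t \<in> ?Z" "?lt1 (h R) t"
        using False \<open>h R \<in> ?Z\<close> by blast
      have "s \<in> R" "t \<in> R"
        using s t z.trans[unfolded topZ, of d "h R" t] dZ \<open>h R \<in> ?Z\<close> \<open>?lt1 d (h R)\<close>
        by (auto simp: R_def)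
      \<comment> \<open>On \<open>R\<close> the order of \<open>h\<close> is \<open>?lt1\<close> or
        its reverse, so its least element \<open>h R\<close> is an endpoint for \<open>?lt1\<close>;
        but \<open>s\<close> and \<open>t\<close> lie on both sides of it.\<close>
      then show thesis
        using ordered_connected_subspace_unique[OF z.ordered_connected_axioms RZ
            h.ordered_connected_axioms subset_refl R_conn] n s(3) t(2) by blast
    qed
  qed
qed

section \<open>The equivalence, assembled from the two directions\<close>

theorem theorem1p1:
  fixes X :: "'a topology"
  assumes "infinite (topspace X)"
    and "connected_space X"
    and "Hausdorff_space X"
  shows "compact_space X \<and> orderable_space X \<longleftrightarrow>
    (\<forall>p\<in>topspace X. \<exists>f. continuous_selection (subtopology X (topspace X - {p})) f)"
proof
  assume "compact_space X \<and> orderable_space X"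
  then show "\<forall>p\<in>topspace X. \<exists>f. continuous_selection (subtopology X (topspace X - {p})) f"
    using compact_orderable_selection[OF assms(2,3)] by simp
next
  assume "\<forall>p\<in>topspace X. \<exists>f. continuous_selection (subtopology X (topspace X - {p})) f"
  then have sel: "\<exists>f. continuous_selection (subtopology X (topspace X - {q})) f"
    if "q \<in> topspace X" for q
    using that by simp
  obtain p where p: "p \<in> topspace X" "connectedin X (topspace X - {p})"
    using exists_noncut_point[OF assms sel] by blast
  obtain lt m where "ordered_connected X lt" and m: "m \<in> topspace X"
    "\<And>x. x \<in> topspace X \<Longrightarrow> \<not> lt x m" "\<And>x. x \<in> topspace X \<Longrightarrow> \<not> lt p x"
    by (rule order_from_noncut_point[OF assms sel p]) (assumption, rule that)
  then interpret o: ordered_connected X lt by simp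
  have min: "\<exists>a\<in>S. \<forall>s\<in>S. \<not> lt s a" if "closedin X S" "S \<noteq> {}" for S
    using o.closed_min_of_selections[OF assms(3) m(1,2) p(1) m(3) sel that] by blast
  \<comment> \<open>Maxima are minima for the reversed order, where \<open>p\<close> and
    \<open>m\<close> exchange their roles as endpoints.\<close>
  have max: "\<exists>a\<in>S. \<forall>s\<in>S. \<not> lt a s" if "closedin X S" "S \<noteq> {}" for S
    using ordered_connected.closed_min_of_selections[OF o.dual assms(3) p(1) m(3) m(1,2) sel that]
    by blast
  show "compact_space X \<and> orderable_space X"
    using o.closed_min_max_imp_compact[OF min max] o.closed_min_max_imp_orderable[OF min max]
    by blast
qed

end
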